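(* Let $B$ be a non-empty (having at least one edge) prime orientable bouquet. Then ${}^{\partial}\varepsilon_{B}(z)=2^{e(B)}z^{b}$ for some integer $b\ge 0$ if and only if $B=B_{2i+1}$ for some integer $i\ge 0$, where $B_t$ denotes the bouquet with signed rotation $(1,2,\ldots,t,1,2,\ldots,t)$.
   Context: Ribbon graphs are finite, possibly non-orientable, considered up to equivalence. For a ribbon graph $G$, let $v(G),e(G),f(G)$ be its numbers of vertices, edges and boundary components. For connected $G$ the Euler genus $\varepsilon(G)$ is defined by $2-\varepsilon(G)=v(G)-e(G)+f(G)$. For $A\subseteq E(G)$ the partial dual $G^{A}$ is obtained as follows: take the spanning ribbon subgraph $(V(G),A)$, glue a disc to $G$ along each boundary component of this subgraph (these discs are the vertex-discs of $G^A$), and remove the interiors of all vertex-discs of $G$; the edge-ribbons are kept as the edges of $G^A$. The partial-dual Euler genus polynomial of $G$ is ${}^{\partial}\varepsilon_{G}(z)=\sum_{A\subseteq E(G)}z^{\varepsilon(G^{A})}$. A bouquet is a ribbon graph with exactly one vertex. A loop $e$ at the vertex-disc $v$ is twisted if $e\cup v$ is homeomorphic to a Möbius band, and untwisted otherwise. A bouquet is orientable if and only if all its edges are untwisted loops. A bouquet is represented by a signed rotation: the cyclic ordering of its half-edges around the vertex, where the two half-edges of an untwisted loop get the same sign $+$ and the two half-edges of a twisted loop get different signs; the sign $+$ is omitted (so all loops of $B_t$ are untwisted). The intersection graph $I(B)$ of a bouquet $B$ is the graph with vertex set $E(B)$ in which distinct $e$ and $f$ are adjacent if and only if their ends are met in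 the cyclic order $e\cdots f\cdots e\cdots f\cdots$ when travelling around the boundary of the unique vertex of $B$. A bouquet is prime if its intersection graph is connected. *)

theory Defs
  imports
    "Graph_Theory.Digraph_Component"
    "HOL-Computational_Algebra.Polynomial"
begin

section \<open>Ribbon graphs\<close>

text \<open>
  A ribbon graph is encoded by its flags, the four corners of every edge-ribbon (a ribbon is a
  rectangle; two opposite arcs of its boundary, its ends, are glued to vertex-discs, the other
  two are its sides).  From a given corner,
    \<^item> \<open>tau0\<close> leads along a side of the ribbon to the corner at its other end,
    \<^item> \<open>tau2\<close> leads along the end of the ribbon to the other corner of this end,
    \<^item> \<open>tau1\<close> leads along the boundary of the vertex-disc, away from the ribbon, to the nearest
      corner of a ribbon (possibly of the same one).
  No orientation is involved, so non-orientable ribbon graphs are covered.  An isolated vertex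
  carries no flag; only the number of such vertices is recorded.
\<close>

record 'a ribbon_graph =
  flags :: "'a set"
  tau0 :: "'a \<Rightarrow> 'a"
  tau1 :: "'a \<Rightarrow> 'a"
  tau2 :: "'a \<Rightarrow> 'a"
  isolated :: nat

locale ribbon_graph =
  fixes G :: "'a ribbon_graph"
  assumes finite_flags: "finite (flags G)"
    and tau0_flags: "x \<in> flags G \<Longrightarrow> tau0 G x \<in> flags G"
    and tau1_flags: "x \<in> flags G \<Longrightarrow> tau1 G x \<in> flags G"
    and tau2_flags: "x \<in> flags G \<Longrightarrow> tau2 G x \<in> flags G"
    and tau0_invol: "x \<in> flags G \<Longrightarrow> tau0 G (tau0 G x) = x"
    and tau1_invol: "x \<in> flags G \<Longrightarrow> tau1 G (tau1 G x) = x"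
    and tau2_invol: "x \<in> flags G \<Longrightarrow> tau2 G (tau2 G x) = x"
    and tau0_neq: "x \<in> flags G \<Longrightarrow> tau0 G x \<noteq> x"
    and tau1_neq: "x \<in> flags G \<Longrightarrow> tau1 G x \<noteq> x"
    and tau2_neq: "x \<in> flags G \<Longrightarrow> tau2 G x \<noteq> x"
    and tau0_tau2_commute: "x \<in> flags G \<Longrightarrow> tau0 G (tau2 G x) = tau2 G (tau0 G x)"
    and tau0_tau2_neq: "x \<in> flags G \<Longrightarrow> tau0 G x \<noteq> tau2 G x"

definition orbits :: "'a set \<Rightarrow> ('a \<Rightarrow> 'a) \<Rightarrow> ('a \<Rightarrow> 'a) \<Rightarrow> 'a set set" where
  "orbits F f g = F // ({(x, f x) | x. x \<in> F} \<union> {(x, g x) | x. x \<in> F})\<^sup>*"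

text \<open>An edge is identified with the set of its four flags.\<close>

definition edges :: "'a ribbon_graph \<Rightarrow> 'a set set" where
  "edges G = orbits (flags G) (tau0 G) (tau2 G)"

definition num_vertices :: "'a ribbon_graph \<Rightarrow> nat" where
  "num_vertices G = card (orbits (flags G) (tau1 G) (tau2 G)) + isolated G"

definition num_edges :: "'a ribbon_graph \<Rightarrow> nat" where
  "num_edges G = card (edges G)"

definition num_boundary :: "'a ribbon_graph \<Rightarrow> nat" where
  "num_boundary G = card (orbits (flags G) (tau0 G) (tau1 G)) + isolated G"

text \<open>Equivalence of ribbon graphs.\<close>

definition ribbon_equiv :: "'a ribbon_graph \<Rightarrow> 'b ribbon_graph \<Rightarrow> bool" where
  "ribbon_equiv G H \<longleftrightarrow> isolated G = isolated H \<and>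
     (\<exists>\<phi>. bij_betw \<phi> (flags G) (flags H) \<and>
       (\<forall>x\<in>flags G. \<phi> (tau0 G x) = tau0 H (\<phi> x) \<and>
                    \<phi> (tau1 G x) = tau1 H (\<phi> x) \<and>
                    \<phi> (tau2 G x) = tau2 H (\<phi> x)))"

section \<open>Partial duals and the partial-dual Euler genus polynomial\<close>

text \<open>
  The Euler genus of a connected ribbon graph; it is only used for these.
\<close>

definition euler_genus :: "'a ribbon_graph \<Rightarrow> int" where
  "euler_genus G = 2 - (int (num_vertices G) - int (num_edges G) + int (num_boundary G))"

text \<open>
  Following a boundary component of the spanning ribbon subgraph \<open>(V(G), A)\<close>, one moves
  along the vertex-discs (\<open>tau1\<close>), along the sides of the ribbons in \<open>A\<close> (\<open>tau0\<close>), and along the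
  arcs to which the removed ribbons had been attached (\<open>tau2\<close>).  These curves bound the
  vertex-discs of the partial dual.  The ribbons stay, but for those in \<open>A\<close> the former
  sides are the arcs attached to the new vertex-discs, and the former ends become sides.
\<close>

definition partial_dual :: "'a ribbon_graph \<Rightarrow> 'a set set \<Rightarrow> 'a ribbon_graph" where
  "partial_dual G A = G\<lparr>
     tau0 := (\<lambda>x. if x \<in> \<Union>A then tau2 G x else tau0 G x),
     tau2 := (\<lambda>x. if x \<in> \<Union>A then tau0 G x else tau2 G x)\<rparr>"

text \<open>
  Partial duals of a connected ribbon graph are connected, and the Euler genus of a connected
  ribbon graph is a non-negative integer, so \<open>nat\<close> is only a change of type here.
\<close>

definition partial_dual_genus_poly :: "'a ribbon_graph \<Rightarrow> int poly" where
  "partial_dual_genus_poly G =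
     (\<Sum>A\<in>Pow (edges G). monom 1 (nat (euler_genus (partial_dual G A))))"

section \<open>Bouquets\<close>

definition bouquet :: "'a ribbon_graph \<Rightarrow> bool" where
  "bouquet G \<longleftrightarrow> ribbon_graph G \<and> num_vertices G = 1"

text \<open>
  The surface formed by all vertex-discs and the ribbons in \<open>A\<close> is orientable: \<open>c\<close> tells for each
  flag whether leaving the ribbon at this corner along the boundary of the vertex-disc agrees
  with the orientation of the disc, and the orientations of the discs have to match
  along the ribbons in \<open>A\<close>.
\<close>

definition orientable_on :: "'a ribbon_graph \<Rightarrow> 'a set set \<Rightarrow> bool" where
  "orientable_on G A \<longleftrightarrow> (\<exists>c :: 'a \<Rightarrow> bool.
     (\<forall>x\<in>flags G. c (tau1 G x) \<noteq> c x \<and> c (tau2 G x) \<noteq> c x) \<and>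
     (\<forall>x\<in>flags G \<inter> \<Union>A. c (tau0 G x) \<noteq> c x))"

definition orientable :: "'a ribbon_graph \<Rightarrow> bool" where
  "orientable G \<longleftrightarrow> orientable_on G (edges G)"

text \<open>
  In a bouquet every edge is a loop, and a disc with one ribbon attached is a Moebius band iff it
  is not orientable.
\<close>

definition twisted :: "'a ribbon_graph \<Rightarrow> 'a set \<Rightarrow> bool" where
  "twisted G e \<longleftrightarrow> \<not> orientable_on G {e}"

text \<open>
  Starting at a flag \<open>x\<close>, the map \<open>tau2 \<circ> tau1\<close> travels around the boundary of the vertex and
  visits one flag of each half-edge; a bouquet has \<open>2 * num_edges G\<close> half-edges.
\<close>

definition interlaced :: "'a ribbon_graph \<Rightarrow> 'a set \<Rightarrow> 'a set \<Rightarrow> bool" where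
  "interlaced G e f \<longleftrightarrow> e \<noteq> f \<and>
     (\<exists>x i j k. x \<in> e \<and> 0 < i \<and> i < j \<and> j < k \<and> k < 2 * num_edges G \<and>
        ((tau2 G \<circ> tau1 G) ^^ i) x \<in> f \<and>
        ((tau2 G \<circ> tau1 G) ^^ j) x \<in> e \<and>
        ((tau2 G \<circ> tau1 G) ^^ k) x \<in> f)"

definition intersection_graph :: "'a ribbon_graph \<Rightarrow> 'a set pair_pre_digraph" where
  "intersection_graph G =
     \<lparr>pverts = edges G, parcs = {(e, f). e \<in> edges G \<and> f \<in> edges G \<and> interlaced G e f}\<rparr>"

definition prime_bouquet :: "'a ribbon_graph \<Rightarrow> bool" where
  "prime_bouquet G \<longleftrightarrow>
     bouquet G \<and> Digraph_Component.connected (with_proj (intersection_graph G))"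

section \<open>Signed rotations\<close>

text \<open>
  A signed rotation lists the half-edges around the vertex as pairs of an edge label and a sign,
  \<open>True\<close> standing for \<open>+\<close>.
\<close>

definition signed_rotation :: "('l \<times> bool) list \<Rightarrow> bool" where
  "signed_rotation w \<longleftrightarrow>
     (\<forall>k<length w. \<exists>!l. l < length w \<and> l \<noteq> k \<and> fst (w ! l) = fst (w ! k))"

definition mate :: "('l \<times> bool) list \<Rightarrow> nat \<Rightarrow> nat" where
  "mate w k = (THE l. l < length w \<and> l \<noteq> k \<and> fst (w ! l) = fst (w ! k))"

text \<open>
  The flags \<open>(k, False)\<close> and \<open>(k, True)\<close> are the first and the last corner of the \<open>k\<close>-th half-edge
  when travelling around the vertex.  The sides of an untwisted loop (equal signs) join first
  corners to last corners, those of a twisted loop join corners of the same kind.  The empty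
  rotation yields an isolated vertex.
\<close>

definition bouquet_of :: "('l \<times> bool) list \<Rightarrow> (nat \<times> bool) ribbon_graph" where
  "bouquet_of w = \<lparr>
     flags = {..<length w} \<times> UNIV,
     tau0 = (\<lambda>(k, s). (mate w k, if snd (w ! k) = snd (w ! mate w k) then \<not> s else s)),
     tau1 = (\<lambda>(k, s). if s then (Suc k mod length w, False)
                      else ((k + length w - 1) mod length w, True)),
     tau2 = (\<lambda>(k, s). (k, \<not> s)),
     isolated = (if w = [] then 1 else 0)\<rparr>"

definition bouquet_B :: "nat \<Rightarrow> (nat \<times> bool) ribbon_graph" where
  "bouquet_B t = bouquet_of (map (\<lambda>a. (a, True)) ([1..<Suc t] @ [1..<Suc t]))"

section \<open>Consistency of the definitions\<close>

lemma edge_closed: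
  assumes "e \<in> edges G" "x \<in> e" "x \<in> flags G"
  shows "tau0 G x \<in> e" "tau2 G x \<in> e"
proof -
  let ?R = "{(x, tau0 G x) | x. x \<in> flags G} \<union> {(x, tau2 G x) | x. x \<in> flags G}"
  obtain z where e: "e = ?R\<^sup>* `` {z}"
    using assms(1) unfolding edges_def orbits_def by (rule quotientE)
  have z: "(z, x) \<in> ?R\<^sup>*" using assms(2) unfolding e by simp
  have "(x, tau0 G x) \<in> ?R" "(x, tau2 G x) \<in> ?R" using assms(3) by blast+
  with z have "(z, tau0 G x) \<in> ?R\<^sup>*" "(z, tau2 G x) \<in> ?R\<^sup>*"
    by (blast intro: rtrancl.rtrancl_into_rtrancl)+
  then show "tau0 G x \<in> e" "tau2 G x \<in> e" unfolding e by simp_all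
qed

lemma edges_cover: "x \<in> flags G \<Longrightarrow> x \<in> \<Union>(edges G)"
  unfolding edges_def orbits_def quotient_def by (rule UnionI[OF UN_I]) blast+

lemma ribbon_graph_partial_dual:
  assumes "ribbon_graph G" and A: "A \<subseteq> edges G"
  shows "ribbon_graph (partial_dual G A)"
proof -
  interpret ribbon_graph G by fact
  have closed: "tau0 G x \<in> \<Union>A" "tau2 G x \<in> \<Union>A" if "x \<in> flags G" "x \<in> \<Union>A" for x
    using that A edge_closed[of _ G x] by blast+
  have c0: "tau0 G x \<in> \<Union>A \<longleftrightarrow> x \<in> \<Union>A" if "x \<in> flags G" for x
    using closed(1)[OF that] closed(1)[OF tau0_flags[OF that]] tau0_invol[OF that] by auto
  have c2: "tau2 G x \<in> \<Union>A \<longleftrightarrow> x \<in> \<Union>A" if "x \<in> flags G" for x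
    using closed(2)[OF that] closed(2)[OF tau2_flags[OF that]] tau2_invol[OF that] by auto
  show ?thesis
  proof unfold_locales
    fix x assume "x \<in> flags (partial_dual G A)"
    then have x: "x \<in> flags G" by (simp add: partial_dual_def)
    note facts = x tau0_flags[OF x] tau1_flags[OF x] tau2_flags[OF x] tau0_invol[OF x]
      tau1_invol[OF x] tau2_invol[OF x] tau0_neq[OF x] tau1_neq[OF x] tau2_neq[OF x]
      tau0_tau2_commute[OF x] tau0_tau2_neq[OF x] tau0_tau2_neq[OF x, symmetric] c0[OF x] c2[OF x]
    show "tau0 (partial_dual G A) x \<in> flags (partial_dual G A)"
      using facts by (simp add: partial_dual_def del: Union_iff UN_iff)
    show "tau1 (partial_dual G A) x \<in> flags (partial_dual G A)"
      using facts by (simp add: partial_dual_def del: Union_iff UN_iff)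
    show "tau2 (partial_dual G A) x \<in> flags (partial_dual G A)"
      using facts by (simp add: partial_dual_def del: Union_iff UN_iff)
    show "tau0 (partial_dual G A) (tau0 (partial_dual G A) x) = x"
      using facts by (simp add: partial_dual_def del: Union_iff UN_iff)
    show "tau1 (partial_dual G A) (tau1 (partial_dual G A) x) = x"
      using facts by (simp add: partial_dual_def del: Union_iff UN_iff)
    show "tau2 (partial_dual G A) (tau2 (partial_dual G A) x) = x"
      using facts by (simp add: partial_dual_def del: Union_iff UN_iff)
    show "tau0 (partial_dual G A) x \<noteq> x"
      using facts by (simp add: partial_dual_def del: Union_iff UN_iff)
    show "tau1 (partial_dual G A) x \<noteq> x"
      using facts by (simp add: partial_dual_def del: Union_iff UN_iff)
    show "tau2 (partial_dual G A) x \<noteq> x"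
      using facts by (simp add: partial_dual_def del: Union_iff UN_iff)
    show "tau0 (partial_dual G A) (tau2 (partial_dual G A) x) = tau2 (partial_dual G A) (tau0 (partial_dual G A) x)"
      using facts by (simp add: partial_dual_def del: Union_iff UN_iff)
    show "tau0 (partial_dual G A) x \<noteq> tau2 (partial_dual G A) x"
      using facts by (simp add: partial_dual_def del: Union_iff UN_iff)
  qed (simp add: partial_dual_def finite_flags)
qed

lemma bouquet_orientable_iff:
  assumes "bouquet G"
  shows "orientable G \<longleftrightarrow> (\<forall>e\<in>edges G. \<not> twisted G e)"
proof -
  interpret ribbon_graph G using assms by (simp add: bouquet_def)
  define alt where "alt c \<longleftrightarrow> (\<forall>x\<in>flags G. c (tau1 G x) \<noteq> c x \<and> c (tau2 G x) \<noteq> c x)"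
    for c :: "'a \<Rightarrow> bool"
  have on: "orientable_on G A \<longleftrightarrow> (\<exists>c. alt c \<and> (\<forall>x\<in>flags G \<inter> \<Union>A. c (tau0 G x) \<noteq> c x))" for A
    unfolding orientable_on_def alt_def by (rule refl)
  define R where "R = {(x, tau1 G x) |x. x \<in> flags G} \<union> {(x, tau2 G x) |x. x \<in> flags G}"
  have eq: "(c x = d x) = (c y = d y)" if c: "alt c" and d: "alt d" and xy: "(x, y) \<in> R\<^sup>*" for c d x y
    using xy
  proof induction
    case base
    show ?case by (rule refl)
  next
    case (step y z)
    then have "y \<in> flags G" "z = tau1 G y \<or> z = tau2 G y" by (auto simp: R_def)
    then have "c z \<noteq> c y" "d z \<noteq> d y" using c d unfolding alt_def by metis+
    then show ?case using step.IH by argo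
  qed
  have conn: "(x, y) \<in> R\<^sup>*" if x: "x \<in> flags G" and y: "y \<in> flags G" for x y
  proof -
    let ?O = "orbits (flags G) (tau1 G) (tau2 G)"
    have O: "?O = flags G // R\<^sup>*" unfolding orbits_def R_def by (rule refl)
    have x': "R\<^sup>* `` {x} \<in> ?O" and y': "R\<^sup>* `` {y} \<in> ?O"
      unfolding O by (rule quotientI, fact)+
    have "finite ?O" unfolding O quotient_def using finite_flags by (rule finite_UN_I) simp
    then have "card ?O \<noteq> 0" using x' by auto
    then have "card ?O = 1" using assms by (simp add: bouquet_def num_vertices_def)
    then have "R\<^sup>* `` {x} = R\<^sup>* `` {y}"
      using x' y' by (metis card_1_singletonE singletonD)
    moreover have "y \<in> R\<^sup>* `` {y}" by simp
    ultimately show ?thesis by (metis Image_singleton_iff)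
  qed
  show ?thesis
  proof
    assume "orientable G"
    then obtain c where c: "alt c" "\<forall>x\<in>flags G \<inter> \<Union>(edges G). c (tau0 G x) \<noteq> c x"
      unfolding orientable_def on by (elim exE conjE)
    show "\<forall>e\<in>edges G. \<not> twisted G e"
      unfolding twisted_def on using c by (auto simp del: UN_iff)
  next
    assume untw: "\<forall>e\<in>edges G. \<not> twisted G e"
    have ex: "\<exists>c. alt c \<and> c (tau0 G x) \<noteq> c x" if x: "x \<in> flags G" for x
    proof -
      obtain e where e: "e \<in> edges G" "x \<in> e" using edges_cover[OF x] by (rule UnionE)
      then obtain c where "alt c" "\<forall>x\<in>flags G \<inter> \<Union>{e}. c (tau0 G x) \<noteq> c x"
        using untw unfolding twisted_def on not_not by (metis (no_types, lifting))
      then show ?thesis using x e(2) by auto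
    qed
    show "orientable G"
    proof (cases "flags G = {}")
      case True
      then show ?thesis by (simp add: orientable_def orientable_on_def)
    next
      case False
      then obtain d where d: "alt d" using ex by auto
      have "d (tau0 G x) \<noteq> d x" if x: "x \<in> flags G" for x
      proof -
        obtain c where c: "alt c" "c (tau0 G x) \<noteq> c x" using ex[OF x] by auto
        show ?thesis using eq[OF c(1) d conn[OF x tau0_flags[OF x]]] c(2) by argo
      qed
      then show ?thesis using d unfolding orientable_def on by auto
    qed
  qed
qed

lemma ribbon_graph_bouquet_of:
  assumes "signed_rotation w"
  shows "ribbon_graph (bouquet_of w)"
proof -
  let ?n = "length w"
  have mate: "mate w k < ?n \<and> mate w k \<noteq> k \<and> fst (w ! mate w k) = fst (w ! k)" if "k < ?n" for k
    using assms that theI'[of "\<lambda>l. l < ?n \<and> l \<noteq> k \<and> fst (w ! l) = fst (w ! k)"]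
    unfolding signed_rotation_def mate_def by blast
  have invol: "mate w (mate w k) = k" if "k < ?n" for k
  proof -
    have "\<exists>!l. l < ?n \<and> l \<noteq> mate w k \<and> fst (w ! l) = fst (w ! mate w k)"
      using assms mate[OF that] unfolding signed_rotation_def by blast
    then show ?thesis using mate[OF that] mate[of "mate w k"] that by metis
  qed
  have s: "(Suc k mod ?n + ?n - 1) mod ?n = k" if "k < ?n" for k
    using that by (cases "Suc k = ?n") auto
  have p: "Suc ((k + ?n - 1) mod ?n) mod ?n = k" if "k < ?n" for k
    using that by (cases k) (auto simp: mod_Suc_eq)
  show ?thesis
    by unfold_locales
      (auto simp: bouquet_of_def mate invol s p simp del: One_nat_def split: if_splits
            intro!: mod_less_divisor)
qed

lemma ribbon_graph_bouquet_B: "ribbon_graph (bouquet_B t)"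
proof -
  let ?w = "map (\<lambda>a. (a, True)) ([1..<Suc t] @ [1..<Suc t])"
  have nth: "fst (?w ! k) = (if k < t then Suc k else Suc (k - t))" if "k < 2 * t" for k
    using that by (auto simp: nth_append simp del: upt_Suc)
  have "\<exists>!l. l < length ?w \<and> l \<noteq> k \<and> fst (?w ! l) = fst (?w ! k)" if "k < length ?w" for k
  proof (rule ex1I[of _ "if k < t then k + t else k - t"])
    have k: "k < 2 * t" using that by (simp del: upt_Suc)
    show "(if k < t then k + t else k - t) < length ?w \<and> (if k < t then k + t else k - t) \<noteq> k \<and>
        fst (?w ! (if k < t then k + t else k - t)) = fst (?w ! k)"
      using k nth[OF k] nth[of "k + t"] nth[of "k - t"] by (auto simp del: upt_Suc)
    show "l = (if k < t then k + t else k - t)"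
      if "l < length ?w \<and> l \<noteq> k \<and> fst (?w ! l) = fst (?w ! k)" for l
    proof -
      have l: "l < 2 * t" using that by (simp del: upt_Suc)
      show ?thesis using that nth[OF k] nth[OF l] k l by (auto split: if_splits)
    qed
  qed
  then have "signed_rotation ?w" unfolding signed_rotation_def by blast
  then show ?thesis unfolding bouquet_B_def by (rule ribbon_graph_bouquet_of)
qed

end

theory Submission
  imports Defs "HOL-Combinatorics.Orbits"
begin

text \<open>
  In an orientable bouquet the boundary components of the spanning ribbon subgraph with edge set
  \<open>A\<close> are the cycles of a permutation of the half-edges, and adding an edge to \<open>A\<close> multiplies it by
  a transposition, so their number \<open>f(A)\<close> changes by exactly one.  The Euler genus of the partial
  dual at \<open>A\<close> is \<open>e + 2 - f(A) - f(E - A)\<close>, so the polynomial is a monomial iff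
  \<open>f(A) + f(E - A) = f(E) + 1\<close> for all \<open>A\<close>.  For a single edge this says that its sides
  lie on different boundary components of the bouquet; for two interlaced edges it then says that
  both lie on the same two components.  If the bouquet is prime, it thus has only two
  boundary components, and a set \<open>A\<close> of two edges that are not interlaced would give
  \<open>f(E - A) = 2 + 1 - 3 = 0\<close>.  Hence all edges are interlaced, that is, the ends of each are
  antipodal, and \<open>e\<close> is odd because \<open>f(A) + |A|\<close> is odd.  Conversely, for antipodal ends every boundary
  component passes every edge, so \<open>f(A) \<le> 2\<close>, and parity makes \<open>f(A) + f(E - A) = 3\<close> if \<open>e\<close> is odd.
\<close>

section \<open>Cycles of a permutation multiplied by a transposition\<close>

lemma orbit_eq_iff:
  assumes "permutation p"
  shows "orbit p x = orbit p y \<longleftrightarrow> x \<in> orbit p y"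
proof
  assume "orbit p x = orbit p y"
  then show "x \<in> orbit p y" using permutation_self_in_orbit[OF assms, of x] by simp
next
  assume x: "x \<in> orbit p y"
  then have "y \<in> orbit p x" using permutation_self_in_orbit[OF assms, of y] by (metis orbit_swap)
  with x show "orbit p x = orbit p y" by (auto intro: orbit_trans)
qed

lemma orbit_sym: "permutation p \<Longrightarrow> x \<in> orbit p y \<longleftrightarrow> y \<in> orbit p x"
  using orbit_eq_iff[of p x y] orbit_eq_iff[of p y x] by auto

text \<open>From \<open>a\<close> the product follows the cycle of \<open>a\<close> until it would
  close up, is diverted to \<open>b\<close>, and from the cycle of \<open>b\<close> likewise back to
  \<open>a\<close>. Other cycles avoid both points.\<close>

lemma orbit_transpose_merge:
  assumes p: "permutation p" and ab: "b \<notin> orbit p a"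
  shows "orbit (transpose a b \<circ> p) x =
    (if x \<in> orbit p a \<union> orbit p b then orbit p a \<union> orbit p b else orbit p x)"
proof -
  let ?U = "orbit p a \<union> orbit p b"
  define q where "q = transpose a b \<circ> p"
  have q_apply: "q x = transpose a b (p x)" for x by (simp add: q_def)
  have q: "permutation q"
    unfolding q_def by (intro permutation_compose permutation_swap_id p)
  note self = permutation_self_in_orbit[OF p] permutation_self_in_orbit[OF q]
  obtain k where k: "0 < k" "(p ^^ k) a = a" and k_min: "\<And>j. 0 < j \<Longrightarrow> j < k \<Longrightarrow> (p ^^ j) a \<noteq> a"
  proof -
    have "\<exists>k. 0 < k \<and> (p ^^ k) a = a" using permutation_self[OF p, of a] by blast
    from LeastI_ex[OF this] not_less_Least show thesis
      by (intro that[of "LEAST k. 0 < k \<and> (p ^^ k) a = a"]) blast+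
  qed
  have first: "(q ^^ j) a = (p ^^ j) a" if "j < k" for j
    using that
  proof (induction j)
    case (Suc j)
    have "(p ^^ Suc j) a \<noteq> a" using k_min Suc.prems by blast
    moreover have "(p ^^ Suc j) a \<noteq> b" using ab self(1) funpow_in_orbit by metis
    ultimately show ?case using Suc by (simp add: q_apply)
  qed simp
  have "(q ^^ k) a = b"
  proof -
    obtain j where j: "k = Suc j" using k(1) gr0_implies_Suc by blast
    then have "(q ^^ k) a = transpose a b (p ((p ^^ j) a))" using first[of j] by (simp add: q_apply)
    then show ?thesis using k(2) j by simp
  qed
  then have b: "b \<in> orbit q a" using self(2) funpow_in_orbit by metis
  then have t: "transpose a b y \<in> orbit q x \<longleftrightarrow> y \<in> orbit q x" for x y
    using q by (cases "y = a \<or> y = b") (metis orbit_eq_iff orbit_sym transpose_apply_first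
        transpose_apply_second transpose_apply_other)+
  have sub: "orbit p y \<subseteq> orbit q y" for y
  proof
    fix z assume "z \<in> orbit p y"
    then show "z \<in> orbit q y"
    proof induction
      case base
      show ?case using orbit.base[of q y] by (metis q_apply t)
    next
      case (step z)
      then show ?case using orbit.step[of z q y] by (metis q_apply t)
    qed
  qed
  show ?thesis
  proof (cases "x \<in> ?U")
    case True
    have U: "transpose a b y \<in> ?U \<longleftrightarrow> y \<in> ?U" for y
      using self(1) by (cases "y = a \<or> y = b") auto
    have "orbit q x \<subseteq> ?U"
    proof
      fix z assume "z \<in> orbit q x"
      then show "z \<in> ?U"
      proof induction
        case base
        then show ?case using True U[of "p x"] by (metis UnE UnI1 UnI2 orbit.step q_apply)
      next
        case (step z)
        then show ?case using U[of "p z"] by (metis UnE UnI1 UnI2 orbit.step q_apply)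
      qed
    qed
    moreover have "?U \<subseteq> orbit q x"
    proof -
      have "orbit q x = orbit q a"
        using True sub b q by (metis UnE orbit_eq_iff subsetD)
      moreover have "orbit q b = orbit q a" using b q by (simp add: orbit_eq_iff)
      ultimately show ?thesis using sub by (metis Un_least)
    qed
    ultimately have "orbit q x = ?U" by (rule subset_antisym)
    then show ?thesis using True by (simp add: q_def)
  next
    case False
    have "q z = p z" if "z \<in> orbit p x" for z
    proof -
      have "p z \<in> orbit p x" using that by (rule orbit.step)
      then have "p z \<noteq> a" "p z \<noteq> b" using False p by (auto simp: orbit_sym)
      then show ?thesis by (simp add: q_apply)
    qed
    then have "orbit q x = orbit p x" using orbit_cong[OF self(1)] by metis
    then show ?thesis using False by (simp add: q_def)
  qed
qed

text \<open>Let \<open>k\<close> be the first time at which \<open>p\<close> reaches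
  \<open>b\<close> from \<open>a\<close>. The product returns to \<open>a\<close> instead, so its
  cycle through \<open>a\<close> contains earlier iterates only.\<close>

lemma orbit_transpose_split:
  assumes p: "permutation p" and ab: "a \<noteq> b" "b \<in> orbit p a"
  shows "b \<notin> orbit (transpose a b \<circ> p) a"
proof -
  let ?q = "transpose a b \<circ> p"
  define k where "k = (LEAST k. (p ^^ k) a = b)"
  have "\<exists>k. (p ^^ k) a = b" using ab(2) by (auto simp: orbit_altdef)
  then have k: "(p ^^ k) a = b" unfolding k_def by (rule LeastI_ex)
  have nb: "(p ^^ j) a \<noteq> b" if "j < k" for j
    using that unfolding k_def by (rule not_less_Least)
  \<comment> \<open>A return to \<open>a\<close> at time \<open>j\<close> would bring
    \<open>b\<close> forward to time \<open>k - j\<close>.\<close>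
  have na: "(p ^^ j) a \<noteq> a" if "0 < j" "j < k" for j
  proof
    assume j: "(p ^^ j) a = a"
    have "(p ^^ k) a = (p ^^ (k - j)) ((p ^^ j) a)"
      using that by (simp flip: funpow_add o_apply[of "p ^^ (k - j)"])
    then show False using j k nb[of "k - j"] that by simp
  qed
  have "0 < k" using k ab(1) by (cases k) auto
  have next_in: "?q ((p ^^ j) a) \<in> {(p ^^ i) a | i. i < k}" if "j < k" for j
  proof (cases "Suc j = k")
    case True
    then have "?q ((p ^^ j) a) = (p ^^ 0) a" using k by auto
    then show ?thesis using \<open>0 < k\<close> by blast
  next
    case False
    then have "?q ((p ^^ j) a) = (p ^^ Suc j) a" using nb[of "Suc j"] na[of "Suc j"] that by simp
    then show ?thesis using False that by (metis (mono_tags, lifting) Suc_lessI mem_Collect_eq)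
  qed
  have "orbit ?q a \<subseteq> {(p ^^ i) a | i. i < k}"
  proof
    fix z assume "z \<in> orbit ?q a"
    then show "z \<in> {(p ^^ i) a | i. i < k}"
    proof induction
      case base
      show ?case using next_in[OF \<open>0 < k\<close>] by simp
    next
      case (step z)
      then show ?case using next_in by auto
    qed
  qed
  then show ?thesis using nb by blast
qed

definition num_cycles :: "('a \<Rightarrow> 'a) \<Rightarrow> 'a set \<Rightarrow> nat" where
  "num_cycles p D = card (orbit p ` D)"

lemma num_cycles_merge:
  assumes "finite D" "p permutes D" "a \<in> D" "b \<in> D" "b \<notin> orbit p a"
  shows "num_cycles p D = Suc (num_cycles (transpose a b \<circ> p) D)"
proof -
  let ?U = "orbit p a \<union> orbit p b"
  have p: "permutation p" using assms(1,2) by (auto simp: permutation_permutes)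
  note self = permutation_self_in_orbit[OF p]
  note orb = orbit_transpose_merge[OF p assms(5)]
  have U: "x \<in> ?U \<longleftrightarrow> orbit p x = orbit p a \<or> orbit p x = orbit p b" for x
    using p by (simp add: orbit_eq_iff)
  have neq: "orbit p a \<noteq> orbit p b" using assms(5) self[of b] by metis
  have "orbit (transpose a b \<circ> p) ` D = insert ?U (orbit p ` D - {orbit p a, orbit p b})"
  proof
    show "orbit (transpose a b \<circ> p) ` D \<subseteq> insert ?U (orbit p ` D - {orbit p a, orbit p b})"
      unfolding orb U by auto
    show "insert ?U (orbit p ` D - {orbit p a, orbit p b}) \<subseteq> orbit (transpose a b \<circ> p) ` D"
    proof
      fix X assume "X \<in> insert ?U (orbit p ` D - {orbit p a, orbit p b})"
      then consider "X = ?U" | x where "x \<in> D" "X = orbit p x" "x \<notin> ?U" using U by auto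
      then show "X \<in> orbit (transpose a b \<circ> p) ` D"
      proof cases
        case 1
        then have "X = orbit (transpose a b \<circ> p) a" using orb[of a] self[of a] by simp
        then show ?thesis using assms(3) by blast
      next
        case 2
        then have "X = orbit (transpose a b \<circ> p) x" using orb[of x] by simp
        then show ?thesis using 2(1) by blast
      qed
    qed
  qed
  moreover have "?U \<notin> orbit p ` D"
  proof
    assume "?U \<in> orbit p ` D"
    then obtain x where "orbit p x = ?U" by auto
    then have "a \<in> orbit p x" "b \<in> orbit p x" using self by auto
    then show False using neq p by (metis orbit_eq_iff)
  qed
  moreover have "card (orbit p ` D - {orbit p a, orbit p b}) = card (orbit p ` D) - 2"
    using neq assms(1,3,4) by (subst card_Diff_subset) auto
  moreover have "card {orbit p a, orbit p b} \<le> card (orbit p ` D)"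
    using assms(1,3,4) by (intro card_mono) auto
  ultimately show ?thesis using neq assms(1) by (simp add: num_cycles_def)
qed

text \<open>The transposition is its own inverse, so this is the merge of the two resulting cycles,
  read backwards.\<close>

lemma num_cycles_split:
  assumes "finite D" "p permutes D" "a \<in> D" "b \<in> D" "a \<noteq> b" "b \<in> orbit p a"
  shows "num_cycles (transpose a b \<circ> p) D = Suc (num_cycles p D)"
proof -
  have p: "permutation p" using assms(1,2) by (auto simp: permutation_permutes)
  have "transpose a b \<circ> p permutes D"
    using assms(2-4) by (intro permutes_compose permutes_swap_id)
  from num_cycles_merge[OF assms(1) this assms(3,4) orbit_transpose_split[OF p assms(5,6)]]
  show ?thesis by (simp flip: comp_assoc)
qed

section \<open>Chord diagrams\<close>

text \<open>
  Here \<open>s\<close> travels along the circle from an end of a chord to the next one, and \<open>m\<close> exchanges the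
  two ends of every chord.
\<close>

locale chord_diagram =
  fixes D :: "'a set" and s m :: "'a \<Rightarrow> 'a"
  assumes finite_D: "finite D" and D_nonempty: "D \<noteq> {}"
    and s_permutes: "s permutes D"
    and s_cyclic: "x \<in> D \<Longrightarrow> orbit s x = D"
    and m_closed: "x \<in> D \<Longrightarrow> m x \<in> D"
    and m_neq: "x \<in> D \<Longrightarrow> m x \<noteq> x"
    and m_invol: "x \<in> D \<Longrightarrow> m (m x) = x"
begin

text \<open>A set of chords is encoded by their ends, hence the closure under \<open>m\<close>; it
  has \<open>card S div 2\<close> chords.\<close>

definition chord_set :: "'a set \<Rightarrow> bool" where
  "chord_set S \<longleftrightarrow> S \<subseteq> D \<and> m ` S \<subseteq> S"

text \<open>Traces the boundary of the disc with the ribbons of \<open>S\<close> attached: proceed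
  to the next end and, if a ribbon of \<open>S\<close> sits there, run along its side to the other
  end.\<close>

definition face :: "'a set \<Rightarrow> 'a \<Rightarrow> 'a" where
  "face S x = (if s x \<in> S then m (s x) else s x)"

definition faces :: "'a set \<Rightarrow> nat" where
  "faces S = num_cycles (face S) D"

lemma chord_set_simps [simp]: "chord_set {}" "chord_set D"
  using m_closed by (auto simp: chord_set_def)

lemma chord_set_chord: "y \<in> D \<Longrightarrow> chord_set {y, m y}"
  using m_closed m_invol by (auto simp: chord_set_def)

lemma chord_set_Un: "chord_set S \<Longrightarrow> chord_set T \<Longrightarrow> chord_set (S \<union> T)"
  by (auto simp: chord_set_def)

lemma chord_set_m: "chord_set S \<Longrightarrow> y \<in> D \<Longrightarrow> m y \<in> S \<longleftrightarrow> y \<in> S"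
  using m_invol unfolding chord_set_def by (metis image_subset_iff)

lemma chord_set_Diff: "chord_set S \<Longrightarrow> chord_set T \<Longrightarrow> chord_set (S - T)"
  using chord_set_m[of T] unfolding chord_set_def by blast

lemma chord_set_induct [consumes 1, case_names empty insert]:
  assumes "chord_set S" "P {}"
    and "\<And>S y. chord_set S \<Longrightarrow> P S \<Longrightarrow> y \<in> D \<Longrightarrow> y \<notin> S \<Longrightarrow> P (insert y (insert (m y) S))"
  shows "P S"
  using assms(1)
proof (induction "card S" arbitrary: S rule: less_induct)
  case less
  show ?case
  proof (cases "S = {}")
    case False
    then obtain y where y: "y \<in> S" by blast
    with less.prems have D: "y \<in> D" and "m y \<in> S" by (auto simp: chord_set_def)
    let ?T = "S - {y, m y}"
    have T: "chord_set ?T" using less.prems chord_set_chord[OF D] by (rule chord_set_Diff)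
    have "finite S" using less.prems finite_D finite_subset by (auto simp: chord_set_def)
    then have "card ?T < card S" using y by (intro psubset_card_mono) auto
    then have "P ?T" using less.hyps T by blast
    with T D have "P (insert y (insert (m y) ?T))" by (intro assms(3)) auto
    moreover have "insert y (insert (m y) ?T) = S" using y \<open>m y \<in> S\<close> by blast
    ultimately show ?thesis by simp
  qed (simp add: assms(2))
qed

text \<open>The new chord matters only where the next end is \<open>y\<close> or \<open>m y\<close>;
  there the two values are exchanged. All other values avoid \<open>y\<close> and
  \<open>m y\<close>.\<close>

lemma face_insert:
  assumes "chord_set S" "y \<in> D" "y \<notin> S"
  shows "face (insert y (insert (m y) S)) = transpose y (m y) \<circ> face S"
proof
  fix x
  consider "s x = y" | "s x = m y" | "s x \<in> S" | "s x \<notin> insert y (insert (m y) S)" by blast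
  then show "face (insert y (insert (m y) S)) x = (transpose y (m y) \<circ> face S) x"
  proof cases
    case 1
    then show ?thesis using assms by (simp add: face_def)
  next
    case 2
    then show ?thesis using assms chord_set_m[OF assms(1,2)] by (simp add: face_def m_invol)
  next
    case 3
    moreover from this have "s x \<in> D" "m (s x) \<in> S" using assms(1) by (auto simp: chord_set_def)
    moreover have "m y \<notin> S" using chord_set_m[OF assms(1,2)] assms(3) by simp
    ultimately show ?thesis using assms(3) by (auto simp: face_def transpose_def)
  next
    case 4
    then show ?thesis by (auto simp: face_def)
  qed
qed

lemma face_delete:
  assumes "chord_set S" "y \<in> S"
  shows "face (S - {y, m y}) = transpose y (m y) \<circ> face S"
proof -
  have y: "y \<in> D" "m y \<in> S" using assms by (auto simp: chord_set_def)
  have "insert y (insert (m y) (S - {y, m y})) = S" using y assms(2) by blast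
  with face_insert[OF chord_set_Diff[OF assms(1) chord_set_chord[OF y(1)]] y(1)]
  have "face S = transpose y (m y) \<circ> face (S - {y, m y})" by simp
  then show ?thesis by (simp flip: comp_assoc)
qed

lemma face_permutes: "chord_set S \<Longrightarrow> face S permutes D"
proof (induction rule: chord_set_induct)
  case empty
  have "face {} = s" by (auto simp: face_def)
  then show ?case using s_permutes by simp
next
  case (insert S y)
  then show ?case
    unfolding face_insert[OF insert.hyps(1) insert.hyps(2,3)]
    by (intro permutes_compose permutes_swap_id m_closed)
qed

lemma face_permutation: "chord_set S \<Longrightarrow> permutation (face S)"
  using face_permutes finite_D by (auto simp: permutation_permutes)

section \<open>Counting faces\<close>

lemma faces_insert:
  assumes "chord_set S" "y \<in> D" "y \<notin> S"
  shows "m y \<in> orbit (face S) y \<Longrightarrow> faces (insert y (insert (m y) S)) = Suc (faces S)"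
    and "m y \<notin> orbit (face S) y \<Longrightarrow> faces S = Suc (faces (insert y (insert (m y) S)))"
  unfolding faces_def face_insert[OF assms]
  by (intro num_cycles_split num_cycles_merge finite_D face_permutes assms m_closed
      m_neq[OF assms(2), symmetric]; assumption)+

lemma faces_delete:
  assumes "chord_set S" "y \<in> S"
  shows "m y \<in> orbit (face S) y \<Longrightarrow> faces (S - {y, m y}) = Suc (faces S)"
    and "m y \<notin> orbit (face S) y \<Longrightarrow> faces S = Suc (faces (S - {y, m y}))"
proof -
  have y: "y \<in> D" using assms by (auto simp: chord_set_def)
  show "m y \<in> orbit (face S) y \<Longrightarrow> faces (S - {y, m y}) = Suc (faces S)"
    and "m y \<notin> orbit (face S) y \<Longrightarrow> faces S = Suc (faces (S - {y, m y}))"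
    unfolding faces_def face_delete[OF assms]
    by (intro num_cycles_split num_cycles_merge finite_D face_permutes assms y m_closed
        m_neq[OF y, symmetric]; assumption)+
qed

lemma face_empty: "face {} = s"
  by (auto simp: face_def)

lemma faces_empty: "faces {} = 1"
proof -
  have "orbit s ` D = {D}" using s_cyclic D_nonempty by auto
  then show ?thesis by (simp add: faces_def num_cycles_def face_empty)
qed

lemma faces_pos: "0 < faces S"
  using finite_D D_nonempty by (auto simp: faces_def num_cycles_def card_gt_0_iff)

lemma card_insert_chord:
  assumes "chord_set S" "y \<in> D" "y \<notin> S"
  shows "card (insert y (insert (m y) S)) = card S + 2"
proof -
  have "finite S" using assms(1) finite_D finite_subset by (auto simp: chord_set_def)
  then show ?thesis using assms chord_set_m[OF assms(1,2)] m_neq[OF assms(2)] by auto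
qed

text \<open>Every added chord changes \<open>faces\<close> by exactly one, so the parity of faces
  plus chords stays what it is for the bare disc.\<close>

lemma faces_parity: "chord_set S \<Longrightarrow> even (card S) \<and> odd (faces S + card S div 2)"
proof (induction rule: chord_set_induct)
  case (insert S y)
  then show ?case
    using faces_insert[of S y] by (cases "m y \<in> orbit (face S) y") (auto simp: card_insert_chord)
qed (simp add: faces_empty)

text \<open>A chord adds at most one face. The bound later makes the Euler genus
  non-negative.\<close>

lemma faces_le: "chord_set S \<Longrightarrow> faces S \<le> Suc (card S div 2)"
proof (induction rule: chord_set_induct)
  case (insert S y)
  then show ?case
    using faces_insert[of S y] by (cases "m y \<in> orbit (face S) y") (auto simp: card_insert_chord)
qed (simp add: faces_empty)

section \<open>Crossing chords and balanced diagrams\<close>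

lemma faces_chord:
  assumes "y \<in> D"
  shows "faces {y, m y} = 2"
proof -
  have "m y \<in> orbit (face {}) y" using assms by (simp only: face_empty s_cyclic m_closed)
  then show ?thesis using faces_insert(1)[of "{}" y] assms by (simp add: faces_empty)
qed

text \<open>Phrased through faces: the chord at \<open>y\<close> alone leaves two faces, and the
  chord at \<open>z\<close> joins them. The link to alternating ends is
  \<open>crossing_iff_arc\<close>.\<close>

definition crossing :: "'a \<Rightarrow> 'a \<Rightarrow> bool" where
  "crossing y z \<longleftrightarrow> z \<notin> {y, m y} \<and> m z \<notin> orbit (face {y, m y}) z"

lemma faces_two_chords:
  assumes "y \<in> D" "z \<in> D" "z \<notin> {y, m y}"
  shows "faces ({y, m y} \<union> {z, m z}) = (if crossing y z then 1 else 3)"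
proof -
  have "{y, m y} \<union> {z, m z} = insert z (insert (m z) {y, m y})" by blast
  then show ?thesis
    using faces_insert[OF chord_set_chord[OF assms(1)] assms(2,3)] faces_chord[OF assms(1)] assms(3)
    by (cases "m z \<in> orbit (face {y, m y}) z") (simp_all add: crossing_def)
qed

text \<open>
  The Euler genus of the partial dual at the chords in \<open>S\<close> is
  \<open>card D div 2 + 2 - faces S - faces (D - S)\<close>.
\<close>

definition balanced :: bool where
  "balanced \<longleftrightarrow> (\<forall>S. chord_set S \<longrightarrow> faces S + faces (D - S) = Suc (faces D))"

text \<open>A single chord has two faces, so balance leaves \<open>faces D - 1\<close> for its
  complement: deleting the chord has to merge faces.\<close>

lemma balanced_sides:
  assumes balanced "y \<in> D"
  shows "m y \<notin> orbit (face D) y"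
proof
  assume "m y \<in> orbit (face D) y"
  then have "faces (D - {y, m y}) = Suc (faces D)" using faces_delete(1) assms(2) by simp
  moreover have "faces {y, m y} + faces (D - {y, m y}) = Suc (faces D)"
    using assms chord_set_chord by (simp add: balanced_def)
  ultimately show False using faces_chord[OF assms(2)] by simp
qed

text \<open>
  Deleting \<open>y\<close> merges the two faces along \<open>y\<close>.  Deleting the crossing chord \<open>z\<close> next splits a face,
  so the two faces along \<open>z\<close> are those that have just been merged.
\<close>

lemma balanced_crossing:
  assumes bal: balanced and D: "y \<in> D" "z \<in> D" and "crossing y z"
  shows "{orbit (face D) z, orbit (face D) (m z)} = {orbit (face D) y, orbit (face D) (m y)}"
proof -
  let ?Y = "{y, m y}" and ?Z = "{z, m z}" and ?O = "orbit (face D)"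
  have z: "z \<notin> ?Y" using assms(4) by (simp add: crossing_def)
  have cs: "chord_set (D - ?Y)" using D(1) by (simp add: chord_set_Diff chord_set_chord)
  have "faces (?Y \<union> ?Z) + faces (D - (?Y \<union> ?Z)) = Suc (faces D)"
    using bal D by (simp only: balanced_def chord_set_Un chord_set_chord)
  moreover have "D - (?Y \<union> ?Z) = D - ?Y - ?Z" by blast
  ultimately have two: "faces (D - ?Y - ?Z) = faces D"
    using faces_two_chords[OF D z] assms(4) by simp
  have "faces D = Suc (faces (D - ?Y))"
    using faces_delete(2)[of D y] balanced_sides[OF bal D(1)] D(1) by simp
  then have "m z \<in> orbit (face (D - ?Y)) z"
    using faces_delete(2)[OF cs, of z] D(2) z two by auto
  then have mz: "m z \<in> orbit (transpose y (m y) \<circ> face D) z"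
    using face_delete[of D y] D(1) by simp
  note orb = orbit_transpose_merge[OF face_permutation[of D] balanced_sides[OF bal D(1)]]
  have neq: "m z \<notin> ?O z" using balanced_sides[OF bal D(2)] .
  have p: "permutation (face D)" by (simp add: face_permutation)
  \<comment> \<open>If \<open>z\<close> lay off the merged cycle, its cycle would be one of
    \<open>face D\<close> containing \<open>m z\<close>, contrary to \<open>neq\<close>.\<close>
  have "z \<in> ?O y \<union> ?O (m y)" "m z \<in> ?O y \<union> ?O (m y)"
    using mz neq unfolding orb[simplified] by (auto split: if_splits)
  then have "?O z \<in> {?O y, ?O (m y)}" "?O (m z) \<in> {?O y, ?O (m y)}" "?O z \<noteq> ?O (m z)"
    using p neq by (auto simp: orbit_eq_iff orbit_sym)
  then show ?thesis by auto
qed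

lemma balanced_all_crossing:
  assumes bal: balanced and D: "y \<in> D" "z \<in> D" and "z \<notin> {y, m y}" and "faces D = 2"
  shows "crossing y z"
proof (rule ccontr)
  assume "\<not> crossing y z"
  then have "faces ({y, m y} \<union> {z, m z}) = 3" using faces_two_chords assms by simp
  moreover have "faces ({y, m y} \<union> {z, m z}) + faces (D - ({y, m y} \<union> {z, m z})) = Suc (faces D)"
    using bal D by (simp only: balanced_def chord_set_Un chord_set_chord)
  ultimately show False using faces_pos[of "D - ({y, m y} \<union> {z, m z})"] assms(5) by simp
qed

text \<open>Connectedness enters as \<open>conn\<close>: a property of ends that respects crossing
  and \<open>m\<close> is constant. It is applied to touching the same two faces as a fixed
  chord.\<close>

lemma balanced_faces_2:
  assumes bal: balanced
    and conn: "\<And>P. (\<And>y z. y \<in> D \<Longrightarrow> z \<in> D \<Longrightarrow> crossing y z \<Longrightarrow> P y \<longleftrightarrow> P z) \<Longrightarrow>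
      (\<And>y. y \<in> D \<Longrightarrow> P (m y) \<longleftrightarrow> P y) \<Longrightarrow> \<forall>y\<in>D. \<forall>z\<in>D. P y \<longrightarrow> P z"
  shows "faces D = 2"
proof -
  let ?O = "orbit (face D)"
  obtain x where x: "x \<in> D" using D_nonempty by blast
  define P where "P z \<longleftrightarrow> {?O z, ?O (m z)} = {?O x, ?O (m x)}" for z
  have "\<forall>y\<in>D. \<forall>z\<in>D. P y \<longrightarrow> P z"
  proof (rule conn)
    show "P y \<longleftrightarrow> P z" if "y \<in> D" "z \<in> D" "crossing y z" for y z
      using balanced_crossing[OF bal that] by (simp add: P_def)
    show "P (m y) \<longleftrightarrow> P y" if "y \<in> D" for y
      using that by (simp add: P_def m_invol insert_commute)
  qed
  moreover have "P x" by (simp add: P_def)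
  ultimately have "?O z \<in> {?O x, ?O (m x)}" if "z \<in> D" for z
    using x that unfolding P_def by (metis insertI1)
  then have "?O ` D = {?O x, ?O (m x)}"
    using x m_closed by (intro subset_antisym image_subsetI) auto
  moreover have "?O x \<noteq> ?O (m x)"
    using balanced_sides[OF bal x] face_permutation[of D] 
      permutation_self_in_orbit[of "face D" "m x"] by auto
  ultimately show ?thesis by (simp add: faces_def num_cycles_def)
qed

subsection \<open>Arcs\<close>

text \<open>The iterates of \<open>x\<close> below its least period are distinct and,
  \<open>s\<close> being a single cycle, exhaust \<open>D\<close>; so this period is
  \<open>card D\<close>.\<close>

lemma s_pow_card: "x \<in> D \<Longrightarrow> (s ^^ card D) x = x"
  and s_pow_inj: "x \<in> D \<Longrightarrow> inj_on (\<lambda>k. (s ^^ k) x) {..<card D}"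
  and s_pow_image: "x \<in> D \<Longrightarrow> (\<lambda>k. (s ^^ k) x) ` {..<card D} = D"
proof -
  assume x: "x \<in> D"
  define k where "k = (LEAST k. 0 < k \<and> (s ^^ k) x = x)"
  have "permutation s" using s_permutes finite_D by (auto simp: permutation_permutes)
  then have ex: "\<exists>k. 0 < k \<and> (s ^^ k) x = x" using permutation_self[of s x] by blast
  have k: "0 < k" "(s ^^ k) x = x" using LeastI_ex[OF ex] by (auto simp: k_def)
  have min: "(s ^^ j) x \<noteq> x" if "0 < j" "j < k" for j
    using that not_less_Least[of j "\<lambda>k. 0 < k \<and> (s ^^ k) x = x"] by (auto simp: k_def)
  have im: "(\<lambda>k. (s ^^ k) x) ` {..<k} = D"
    using orbit_altdef_bounded[OF k(2,1)] s_cyclic[OF x] by auto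
  have inj: "inj_on (\<lambda>k. (s ^^ k) x) {..<k}"
  proof -
    have False if "i < j" "j < k" "(s ^^ i) x = (s ^^ j) x" for i j
    proof -
      \<comment> \<open>Equal iterates at times \<open>i\<close> and \<open>j\<close> give an early
        return: after \<open>i\<close> steps, the \<open>k - j\<close> steps that are left from time
        \<open>j\<close> suffice.\<close>
      have "(s ^^ (i + (k - j))) x = (s ^^ (k - j)) ((s ^^ i) x)"
        by (simp only: add.commute[of i] funpow_add o_apply)
      also have "\<dots> = (s ^^ k) x"
        unfolding that(3) using that(2) by (simp flip: funpow_add o_apply[of "s ^^ (k - j)"])
      finally have "(s ^^ (i + (k - j))) x = x" using k(2) by simp
      moreover have "0 < i + (k - j)" "i + (k - j) < k" using that by auto
      ultimately show False by (metis min)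
    qed
    then show ?thesis by (auto simp: inj_on_def) (metis linorder_neqE_nat)
  qed
  have "card D = k" using card_image[OF inj] im by simp
  then show "(s ^^ card D) x = x" "inj_on (\<lambda>k. (s ^^ k) x) {..<card D}"
    "(\<lambda>k. (s ^^ k) x) ` {..<card D} = D" using k inj im by auto
qed

lemma s_pow_closed: "x \<in> D \<Longrightarrow> (s ^^ k) x \<in> D"
  by (induction k) (auto simp: permutes_in_image[OF s_permutes])

text \<open>Half-open: \<open>x\<close> belongs to it, the end reached after \<open>j\<close> steps
  does not when \<open>0 < j < card D\<close>.\<close>

definition arc :: "'a \<Rightarrow> nat \<Rightarrow> 'a set" where
  "arc x j = (\<lambda>k. (s ^^ k) x) ` {..<j}"

text \<open>With only this chord attached, the face follows \<open>s\<close> until it would step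
  onto \<open>m x\<close>, and there it jumps across to \<open>x\<close>.\<close>

lemma arc_chord:
  assumes x: "x \<in> D" and j: "j < card D" "(s ^^ j) x = m x"
  shows "orbit (face {x, m x}) x = arc x j"
proof -
  let ?q = "face {x, m x}"
  have j0: "0 < j" using j(2) m_neq[OF x] by (cases j) auto
  note inj = inj_onD[OF s_pow_inj[OF x]]
  have pow: "(?q ^^ i) x = (s ^^ i) x" if "i < j" for i
    using that
  proof (induction i)
    case (Suc i)
    have "(s ^^ Suc i) x \<noteq> x" using inj[of "Suc i" 0] Suc.prems j(1) by auto
    moreover have "(s ^^ Suc i) x \<noteq> m x" using inj[of "Suc i" j] Suc.prems j by auto
    ultimately show ?case using Suc by (simp add: face_def)
  qed simp
  have "(?q ^^ j) x = x"
  proof -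
    obtain i where i: "j = Suc i" using j0 gr0_implies_Suc by blast
    then have "s ((s ^^ i) x) = m x" using j by simp
    then show ?thesis using i pow[of i] m_invol[OF x] by (simp add: face_def)
  qed
  from orbit_altdef_bounded[OF this j0] have "orbit ?q x = (\<lambda>i. (?q ^^ i) x) ` {..<j}" by auto
  also have "\<dots> = arc x j" unfolding arc_def using pow by (intro image_cong) auto
  finally show ?thesis .
qed

text \<open>The chord at \<open>x\<close> alone has exactly two faces, one of them the arc by
  \<open>arc_chord\<close>; a crossing chord has one end on each.\<close>

lemma crossing_iff_arc:
  assumes x: "x \<in> D" and j: "j < card D" "(s ^^ j) x = m x"
    and z: "z \<in> D" "z \<notin> {x, m x}"
  shows "crossing x z \<longleftrightarrow> (z \<in> arc x j \<longleftrightarrow> m z \<notin> arc x j)"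
proof -
  let ?O = "orbit (face {x, m x})"
  have p: "permutation (face {x, m x})" using x by (simp add: face_permutation chord_set_chord)
  have mx: "m x \<notin> ?O x"
    using orbit_transpose_split[of s x "m x"] face_insert[of "{}" x] x m_neq[OF x] s_permutes finite_D
      s_cyclic[OF x] m_closed[OF x] by (auto simp: face_empty permutation_permutes)
  have "?O x \<noteq> ?O (m x)" using mx permutation_self_in_orbit[OF p] by metis
  moreover have "card (?O ` D) = 2" using faces_chord[OF x] by (simp add: faces_def num_cycles_def)
  moreover have "{?O x, ?O (m x)} \<subseteq> ?O ` D" using x m_closed by auto
  ultimately have im: "?O ` D = {?O x, ?O (m x)}"
    using finite_D by (metis card_2_iff card_subset_eq finite_imageI)
  have "crossing x z \<longleftrightarrow> ?O z \<noteq> ?O (m z)"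
    using z(2) p by (auto simp: crossing_def orbit_eq_iff orbit_sym)
  also have "\<dots> \<longleftrightarrow> (?O z = ?O x \<longleftrightarrow> ?O (m z) \<noteq> ?O x)"
  proof -
    have "?O z \<in> {?O x, ?O (m x)}" "?O (m z) \<in> {?O x, ?O (m x)}"
      using im z(1) m_closed[OF z(1)] by (metis imageI)+
    then show ?thesis using \<open>?O x \<noteq> ?O (m x)\<close> by (elim insertE emptyE) simp_all
  qed
  finally have "crossing x z \<longleftrightarrow> (z \<in> ?O x \<longleftrightarrow> m z \<notin> ?O x)" using p by (simp only: orbit_eq_iff)
  then show ?thesis using arc_chord[OF assms(1-3)] by simp
qed

lemma chord_distance:
  assumes "x \<in> D"
  obtains j where "0 < j" "j < card D" "(s ^^ j) x = m x"
proof -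
  obtain j where "j < card D" "(s ^^ j) x = m x"
    using s_pow_image[OF assms] m_closed[OF assms] by (metis (no_types, lifting) imageE lessThan_iff)
  moreover from this have "0 < j" using m_neq[OF assms] by (cases j) auto
  ultimately show thesis using that by blast
qed

text \<open>Every chord crosses the chord at \<open>x\<close>, so \<open>m\<close> exchanges the two arcs cut off by it.\<close>

lemma all_crossing_antipodal:
  assumes cr: "\<And>z. z \<in> D \<Longrightarrow> z \<notin> {x, m x} \<Longrightarrow> crossing x z" and x: "x \<in> D"
  shows "m x = (s ^^ (card D div 2)) x"
proof -
  obtain j where j: "0 < j" "j < card D" "(s ^^ j) x = m x" using chord_distance[OF x] .
  let ?A = "arc x j"
  have A: "?A \<subseteq> D" unfolding arc_def using s_pow_image[OF x] j(2) by auto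
  have "inj_on (\<lambda>k. (s ^^ k) x) {..<j}"
    using s_pow_inj[OF x] by (rule inj_on_subset) (use j in auto)
  then have cA: "card ?A = j" unfolding arc_def by (simp add: card_image)
  have xA: "x \<in> ?A" unfolding arc_def using j(1) by force
  have mxA: "m x \<notin> ?A"
  proof
    assume "m x \<in> ?A"
    then obtain i where "i < j" "(s ^^ i) x = (s ^^ j) x" using j(3) by (auto simp: arc_def)
    then show False using inj_onD[OF s_pow_inj[OF x], of i j] j by simp
  qed
  have swap: "z \<in> ?A \<longleftrightarrow> m z \<notin> ?A" if "z \<in> D" for z
  proof (cases "z \<in> {x, m x}")
    case True
    then show ?thesis using xA mxA m_invol[OF x] by auto
  next
    case False
    then show ?thesis using crossing_iff_arc[OF x j(2,3) that] cr[OF that] by simp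
  qed
  have inj: "inj_on m D" using m_invol by (metis inj_onI)
  have "m ` ?A = D - ?A"
  proof
    show "m ` ?A \<subseteq> D - ?A" using swap A m_closed by blast
    show "D - ?A \<subseteq> m ` ?A"
    proof
      fix z assume z: "z \<in> D - ?A"
      then have "m z \<in> ?A" using swap by blast
      then show "z \<in> m ` ?A" using m_invol z by (metis DiffD1 imageI)
    qed
  qed
  then have "j = card (D - ?A)" using card_image[OF inj_on_subset[OF inj A]] cA by simp
  also have "\<dots> = card D - j" using A cA finite_D by (simp add: card_Diff_subset finite_subset)
  finally have "card D div 2 = j" using j(1,2) by linarith
  then show ?thesis using j(3) by simp
qed

section \<open>Balance and antipodality\<close>

theorem balanced_antipodal:
  assumes bal: balanced
    and conn: "\<And>P. (\<And>y z. y \<in> D \<Longrightarrow> z \<in> D \<Longrightarrow> crossing y z \<Longrightarrow> P y \<longleftrightarrow> P z) \<Longrightarrow>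
      (\<And>y. y \<in> D \<Longrightarrow> P (m y) \<longleftrightarrow> P y) \<Longrightarrow> \<forall>y\<in>D. \<forall>z\<in>D. P y \<longrightarrow> P z"
  shows "odd (card D div 2)" and "\<forall>x\<in>D. m x = (s ^^ (card D div 2)) x"
proof -
  have f: "faces D = 2" using assms by (rule balanced_faces_2)
  then show "odd (card D div 2)" using faces_parity[of D] by simp
  show "\<forall>x\<in>D. m x = (s ^^ (card D div 2)) x"
  proof
    fix x assume "x \<in> D"
    then show "m x = (s ^^ (card D div 2)) x"
      by (intro all_crossing_antipodal balanced_all_crossing[OF bal _ _ _ f])
  qed
qed

text \<open>
  An antipodal \<open>m\<close> commutes with \<open>s\<close>, so every face visits an end of every chord and there are at
  most two faces; parity decides which of the complementary sets has two.
\<close>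

theorem antipodal_balanced:
  assumes odd: "odd (card D div 2)" and anti: "\<forall>x\<in>D. m x = (s ^^ (card D div 2)) x"
  shows balanced
proof -
  have comm: "s (m x) = m (s x)" if "x \<in> D" for x
    using that anti permutes_in_image[OF s_permutes] by (simp add: funpow_swap1)
  have le2: "faces S \<le> 2" if S: "chord_set S" for S
  proof -
    let ?q = "face S"
    have p: "permutation ?q" using S by (rule face_permutation)
    \<comment> \<open>As \<open>m\<close> commutes with \<open>s\<close>, the jumps across chords
      accumulate to at most one application of \<open>m\<close>.\<close>
    have pow: "(?q ^^ i) x \<in> {(s ^^ i) x, m ((s ^^ i) x)}" if x: "x \<in> D" for x i
    proof (induction i)
      case (Suc i)
      have "(s ^^ i) x \<in> D" "s ((s ^^ i) x) \<in> D"
        using s_pow_closed[OF x] s_pow_closed[OF x, of "Suc i"] by auto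
      then show ?case using Suc comm m_invol by (auto simp: face_def)
    qed simp
    have visit: "y \<in> orbit ?q x \<or> m y \<in> orbit ?q x" if x: "x \<in> D" and y: "y \<in> D" for x y
    proof -
      obtain i where i: "y = (s ^^ i) x" using s_pow_image[OF x] y by blast
      have "(?q ^^ i) x \<in> orbit ?q x" using permutation_self_in_orbit[OF p] funpow_in_orbit by metis
      then show ?thesis using pow[OF x, of i] i by auto
    qed
    obtain x where x: "x \<in> D" using D_nonempty by blast
    \<comment> \<open>Each face visits \<open>x\<close> or \<open>m x\<close>, so these two ends
      represent all faces.\<close>
    have "orbit ?q y \<in> {orbit ?q x, orbit ?q (m x)}" if "y \<in> D" for y
      using visit[OF that x] p by (auto simp: orbit_eq_iff orbit_sym)
    then have "orbit ?q ` D \<subseteq> {orbit ?q x, orbit ?q (m x)}" by blast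
    then have "card (orbit ?q ` D) \<le> card {orbit ?q x, orbit ?q (m x)}" by (intro card_mono) auto
    also have "\<dots> \<le> 2" by (simp add: card_insert_if)
    finally show ?thesis by (simp add: faces_def num_cycles_def)
  qed
  have sum3: "faces S + faces (D - S) = 3" if S: "chord_set S" for S
  proof -
    have T: "chord_set (D - S)" using S by (simp add: chord_set_Diff)
    have "finite S" "S \<subseteq> D" using S finite_D finite_subset by (auto simp: chord_set_def)
    then have "card S + card (D - S) = card D" using finite_D
      by (metis card_Diff_subset card_mono le_add_diff_inverse)
    \<comment> \<open>The two chord counts add up to an odd number, hence so do the two face
      counts.\<close>
    with faces_parity[OF S] faces_parity[OF T] odd
    have "odd (faces S + faces (D - S))" by presburger
    moreover have "faces S = 1 \<or> faces S = 2" "faces (D - S) = 1 \<or> faces (D - S) = 2"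
      using faces_pos[of S] faces_pos[of "D - S"] le2[OF S] le2[OF T] by linarith+
    ultimately show ?thesis by (elim disjE) simp_all
  qed
  from sum3[of D] have "faces D = 2" by (simp add: faces_empty)
  then show ?thesis using sum3 by (simp add: balanced_def)
qed

end

section \<open>From flags to chord diagrams\<close>

lemma orbits_cong:
  "(\<And>x. x \<in> F \<Longrightarrow> f x = f' x) \<Longrightarrow> (\<And>x. x \<in> F \<Longrightarrow> g x = g' x) \<Longrightarrow> orbits F f g = orbits F f' g'"
  unfolding orbits_def by (intro arg_cong[where f = "\<lambda>R. F // R\<^sup>*"]) auto

lemma orbits_commute: "orbits F f g = orbits F g f"
  unfolding orbits_def by (simp add: Un_commute)

text \<open>Both involutions reverse \<open>c\<close>, so an orbit alternates between positive and
  negative elements; double steps, first \<open>f\<close> and then \<open>g\<close>, run through its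
  positive ones in a single cycle.\<close>

lemma card_orbits_eq_num_cycles:
  assumes D: "D = {x \<in> F. c x}" and "finite F"
    and f: "\<And>x. x \<in> F \<Longrightarrow> f x \<in> F \<and> f (f x) = x \<and> c (f x) \<noteq> c x"
    and g: "\<And>x. x \<in> F \<Longrightarrow> g x \<in> F \<and> g (g x) = x \<and> c (g x) \<noteq> c x"
    and p: "p permutes D" and pfg: "\<And>x. x \<in> D \<Longrightarrow> p x = g (f x)"
  shows "card (orbits F f g) = num_cycles p D"
proof -
  define R where "R = {(x, f x) | x. x \<in> F} \<union> {(x, g x) | x. x \<in> F}"
  have fR: "(x, f x) \<in> R" and gR: "(x, g x) \<in> R" if "x \<in> F" for x
    using that by (auto simp: R_def)
  have RE: "x \<in> F \<and> (y = f x \<or> y = g x)" if "(x, y) \<in> R" for x y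
    using that by (auto simp: R_def)
  have "sym R"
  proof (rule symI)
    fix x y assume "(x, y) \<in> R"
    then show "(y, x) \<in> R" using RE f g fR gR by metis
  qed
  then have symR: "(y, x) \<in> R\<^sup>*" if "(x, y) \<in> R\<^sup>*" for x y
    using that by (metis sym_rtrancl symD)
  have perm: "permutation p"
    unfolding permutation_permutes using p D \<open>finite F\<close> by (intro exI[of _ D]) simp
  \<comment> \<open>A positive representative; negative elements move by \<open>g\<close> because
    \<open>p\<close> ends with \<open>g\<close>.\<close>
  define rep where "rep z = (if c z then z else g z)" for z
  have rep_D: "rep z \<in> D" if "z \<in> F" for z
    using that g by (auto simp: rep_def D)
  have R_rep: "(z, rep z) \<in> R\<^sup>*" if "z \<in> F" for z
    using that gR by (auto simp: rep_def)
  have p_R: "(z, p z) \<in> R\<^sup>*" if "z \<in> D" for z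
  proof -
    have "z \<in> F" "f z \<in> F" using that f by (auto simp: D)
    then have "(z, f z) \<in> R" "(f z, p z) \<in> R" using fR gR pfg[OF that] by auto
    then show ?thesis by (meson converse_rtrancl_into_rtrancl r_into_rtrancl)
  qed
  have orbit_R: "(x, y) \<in> R\<^sup>*" if "x \<in> D" "y \<in> orbit p x" for x y
    using that(2)
  proof induction
    case base
    show ?case using p_R[OF that(1)] .
  next
    case (step y)
    then have "y \<in> D" using permutes_orbit_subset[OF p that(1)] by blast
    then show ?case using p_R step.IH by (meson rtrancl_trans)
  qed
  have rep_step: "rep y \<in> orbit p (rep x)" if "(x, y) \<in> R" for x y
  proof -
    note xy = RE[OF that]
    have x: "x \<in> F" using xy by blast
    note self = permutation_self_in_orbit[OF perm]
    consider "y = g x" | "y = f x" "c x" | "y = f x" "\<not> c x" using xy by blast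
    then show ?thesis
    proof cases
      case 1
      then have "rep y = rep x" using g[OF x] by (auto simp: rep_def)
      then show ?thesis using self by simp
    next
      case 2
      then have "rep y = p (rep x)" using f[OF x] pfg[of x] x by (auto simp: rep_def D)
      then show ?thesis by (simp add: orbit.base)
    next
      case 3
      \<comment> \<open>From a negative element, \<open>f\<close> leads one step back along the
        cycle.\<close>
      then have "rep x = p (rep y)" using f[OF x] pfg[of y] by (auto simp: rep_def D)
      then have "rep x \<in> orbit p (rep y)" by (simp add: orbit.base)
      then show ?thesis by (simp only: orbit_sym[OF perm])
    qed
  qed
  have rep_R: "rep y \<in> orbit p (rep x)" if "(x, y) \<in> R\<^sup>*" for x y
    using that
  proof induction
    case base
    show ?case by (rule permutation_self_in_orbit[OF perm])
  next
    case (step y z)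
    then show ?case using rep_step orbit_trans by metis
  qed
  have trace: "R\<^sup>* `` {z} \<inter> D = orbit p (rep z)" if z: "z \<in> F" for z
  proof (intro subset_antisym subsetI IntI)
    fix y assume y: "y \<in> R\<^sup>* `` {z} \<inter> D"
    then have "rep y \<in> orbit p (rep z)" using rep_R by blast
    moreover have "rep y = y" using y by (simp add: rep_def D)
    ultimately show "y \<in> orbit p (rep z)" by simp
  next
    fix y assume y: "y \<in> orbit p (rep z)"
    then show "y \<in> R\<^sup>* `` {z}"
      using orbit_R[OF rep_D[OF z]] R_rep[OF z] by (auto intro: rtrancl_trans)
    show "y \<in> D" using y permutes_orbit_subset[OF p rep_D[OF z]] by blast
  qed
  have O: "orbits F f g = F // R\<^sup>*" unfolding orbits_def R_def ..
  \<comment> \<open>Every orbit meets \<open>D\<close>, so its trace on \<open>D\<close> determines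
    it.\<close>
  have "inj_on (\<lambda>X. X \<inter> D) (F // R\<^sup>*)"
  proof (rule inj_onI)
    fix X Y assume "X \<in> F // R\<^sup>*" "Y \<in> F // R\<^sup>*" and eq: "X \<inter> D = Y \<inter> D"
    then obtain x y where x: "x \<in> F" "X = R\<^sup>* `` {x}" and y: "y \<in> F" "Y = R\<^sup>* `` {y}"
      by (auto elim!: quotientE)
    have "rep x \<in> X \<inter> D" using R_rep[OF x(1)] rep_D[OF x(1)] x(2) by auto
    then have "(y, rep x) \<in> R\<^sup>*" using eq y(2) by auto
    then have "(x, y) \<in> R\<^sup>*" using R_rep[OF x(1)] symR by (meson rtrancl_trans)
    then show "X = Y" unfolding x(2) y(2) using symR by (auto intro: rtrancl_trans)
  qed
  moreover have "(\<lambda>X. X \<inter> D) ` (F // R\<^sup>*) = orbit p ` D"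
  proof -
    have "(\<lambda>X. X \<inter> D) ` (F // R\<^sup>*) = (\<lambda>z. orbit p (rep z)) ` F"
      unfolding quotient_def using trace by (force simp: image_iff)
    also have "\<dots> = orbit p ` D"
    proof (intro subset_antisym subsetI)
      fix X assume "X \<in> orbit p ` D"
      then obtain z where "z \<in> D" "X = orbit p z" by blast
      then have "z \<in> F" "X = orbit p (rep z)" by (auto simp: D rep_def)
      then show "X \<in> (\<lambda>z. orbit p (rep z)) ` F" by blast
    qed (use rep_D in blast)
    finally show ?thesis .
  qed
  ultimately show ?thesis unfolding O num_cycles_def by (metis card_image)
qed

section \<open>Edges as sets of four flags\<close>

context ribbon_graph
begin

definition edge_of :: "'a \<Rightarrow> 'a set" where
  "edge_of x = {x, tau0 G x, tau2 G x, tau0 G (tau2 G x)}"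

lemma edge_of_tau:
  assumes x: "x \<in> flags G"
  shows "edge_of (tau0 G x) = edge_of x" "edge_of (tau2 G x) = edge_of x"
  unfolding edge_of_def
  by (simp_all add: tau0_invol[OF x] tau2_invol[OF x] tau0_tau2_commute[OF x, symmetric]
      tau0_invol[OF tau2_flags[OF x]] insert_commute)

lemma edges_eq: "edges G = edge_of ` flags G"
proof -
  define R where "R = {(x, tau0 G x) | x. x \<in> flags G} \<union> {(x, tau2 G x) | x. x \<in> flags G}"
  have step: "(x, tau0 G x) \<in> R" "(x, tau2 G x) \<in> R" if "x \<in> flags G" for x
    using that by (auto simp: R_def)
  have "R\<^sup>* `` {x} = edge_of x" if x: "x \<in> flags G" for x
  proof
    have "y \<in> flags G \<and> edge_of y = edge_of x" if "(x, y) \<in> R\<^sup>*" for y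
      using that
    proof induction
      case (step y z)
      then have "z = tau0 G y \<or> z = tau2 G y" by (auto simp: R_def)
      then show ?case using step edge_of_tau tau0_flags tau2_flags by metis
    qed (simp add: x)
    moreover have "y \<in> edge_of y" for y by (simp add: edge_of_def)
    ultimately show "R\<^sup>* `` {x} \<subseteq> edge_of x" by blast
    have "(tau2 G x, tau0 G (tau2 G x)) \<in> R" using step tau2_flags[OF x] by blast
    then show "edge_of x \<subseteq> R\<^sup>* `` {x}"
      using step[OF x] by (auto simp: edge_of_def intro: rtrancl_into_rtrancl)
  qed
  then show ?thesis
    unfolding edges_def orbits_def R_def[symmetric] quotient_def by auto
qed

lemma edge_of_in_edges: "x \<in> flags G \<Longrightarrow> edge_of x \<in> edges G"
  by (simp add: edges_eq)

lemma edges_subset_flags: "e \<in> edges G \<Longrightarrow> e \<subseteq> flags G"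
  using tau0_flags tau2_flags by (auto simp: edges_eq edge_of_def)

lemma edge_eq:
  assumes "e \<in> edges G" "x \<in> e"
  shows "e = edge_of x"
proof -
  obtain z where z: "z \<in> flags G" "e = edge_of z" using assms(1) by (auto simp: edges_eq)
  then have "x = z \<or> x = tau0 G z \<or> x = tau2 G z \<or> x = tau0 G (tau2 G z)"
    using assms(2) by (simp add: edge_of_def)
  then show ?thesis
    using edge_of_tau[OF z(1)] edge_of_tau(1)[OF tau2_flags[OF z(1)]] z(2) by (elim disjE) simp_all
qed

lemma finite_edges: "finite (edges G)"
  using finite_flags by (simp add: edges_eq)

lemma mem_Union_edges:
  assumes "A \<subseteq> edges G" "x \<in> flags G"
  shows "x \<in> \<Union>A \<longleftrightarrow> edge_of x \<in> A"
proof
  assume "x \<in> \<Union>A"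
  then show "edge_of x \<in> A" using assms(1) edge_eq by blast
next
  assume "edge_of x \<in> A"
  then show "x \<in> \<Union>A" by (auto simp: edge_of_def)
qed

text \<open>Exchanging \<open>tau0\<close> and \<open>tau2\<close> at some flags leaves the union of
  their graphs unchanged.\<close>

lemma edges_partial_dual: "edges (partial_dual G A) = edges G"
proof -
  have "(y, z) \<in> {(x, tau0 (partial_dual G A) x) | x. x \<in> flags G} \<union>
      {(x, tau2 (partial_dual G A) x) | x. x \<in> flags G} \<longleftrightarrow>
    (y, z) \<in> {(x, tau0 G x) | x. x \<in> flags G} \<union> {(x, tau2 G x) | x. x \<in> flags G}" for y z
    unfolding partial_dual_def by (cases "y \<in> \<Union>A") (auto simp del: Union_iff)
  then have "{(x, tau0 (partial_dual G A) x) | x. x \<in> flags G} \<union>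
      {(x, tau2 (partial_dual G A) x) | x. x \<in> flags G} =
    {(x, tau0 G x) | x. x \<in> flags G} \<union> {(x, tau2 G x) | x. x \<in> flags G}"
    by (intro set_eqI) (simp only: split_paired_all)
  then show ?thesis by (simp add: edges_def orbits_def partial_dual_def)
qed

end

section \<open>The chord diagram of an oriented bouquet\<close>

locale oriented_bouquet = ribbon_graph G for G :: "'a ribbon_graph" +
  fixes c :: "'a \<Rightarrow> bool"
  assumes one_vertex: "num_vertices G = 1" and flags_nonempty: "flags G \<noteq> {}"
    and c_tau0: "x \<in> flags G \<Longrightarrow> c (tau0 G x) \<noteq> c x"
    and c_tau1: "x \<in> flags G \<Longrightarrow> c (tau1 G x) \<noteq> c x"
    and c_tau2: "x \<in> flags G \<Longrightarrow> c (tau2 G x) \<noteq> c x"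
begin

text \<open>Each half-edge is represented by that one of its two flags that is positive for \<open>c\<close>.\<close>

definition D :: "'a set" where
  "D = {x \<in> flags G. c x}"

text \<open>The identity outside \<open>D\<close>, as \<open>permutes\<close> demands.\<close>

definition s :: "'a \<Rightarrow> 'a" where
  "s x = (if x \<in> D then tau2 G (tau1 G x) else x)"

text \<open>From a positive corner \<open>tau0\<close> arrives at the negative corner of the other
  end; \<open>tau2\<close> corrects this.\<close>

definition m :: "'a \<Rightarrow> 'a" where
  "m x = tau2 G (tau0 G x)"

definition darts :: "'a set set \<Rightarrow> 'a set" where
  "darts A = D \<inter> \<Union>A"

lemma D_flags: "x \<in> D \<Longrightarrow> x \<in> flags G"
  by (simp add: D_def)

lemma s_D: "x \<in> D \<Longrightarrow> s x \<in> D"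
  using tau1_flags tau2_flags c_tau1 c_tau2 by (auto simp: s_def D_def)

lemma m_D: "x \<in> D \<Longrightarrow> m x \<in> D"
  using tau0_flags tau2_flags c_tau0 c_tau2 by (auto simp: m_def D_def)

lemma tau2_D_iff: "x \<in> flags G \<Longrightarrow> tau2 G x \<in> D \<longleftrightarrow> x \<notin> D"
  using tau2_flags c_tau2 by (auto simp: D_def)

lemma s_permutes: "s permutes D"
proof (rule bij_imp_permutes)
  have "inj_on s D"
    using tau1_flags tau1_invol tau2_invol by (auto simp: s_def D_def inj_on_def) metis
  then show "bij_betw s D D"
    using s_D finite_flags by (intro bij_betw_imageI endo_inj_surj) (auto simp: D_def)
qed (simp add: s_def)

lemma finite_D: "finite D"
  using finite_flags by (simp add: D_def)

lemma D_nonempty: "D \<noteq> {}"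
  using flags_nonempty tau2_flags tau2_D_iff by auto

lemma card_vertices: "num_vertices G = num_cycles s D + isolated G"
proof -
  have "card (orbits (flags G) (tau1 G) (tau2 G)) = num_cycles s D"
    by (rule card_orbits_eq_num_cycles[where c = c])
      (use finite_flags s_permutes tau1_flags tau1_invol c_tau1 tau2_flags tau2_invol c_tau2 in
        \<open>auto simp: D_def s_def\<close>)
  then show ?thesis by (simp add: num_vertices_def)
qed

text \<open>Flags exist, so some cycle of \<open>s\<close> accounts for the only vertex.\<close>

lemma num_cycles_s: "num_cycles s D = 1" and isolated: "isolated G = 0"
proof -
  have "num_cycles s D \<noteq> 0" using finite_D D_nonempty by (simp add: num_cycles_def)
  then show "num_cycles s D = 1" "isolated G = 0" using card_vertices one_vertex by auto
qed

sublocale chord_diagram D s m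
proof
  fix x assume x: "x \<in> D"
  note facts = D_flags[OF x] tau0_flags tau2_flags tau0_invol tau2_invol tau0_tau2_commute
  show "m x \<in> D" using x by (rule m_D)
  \<comment> \<open>A fixed point of \<open>m\<close> would make \<open>tau0\<close> and
    \<open>tau2\<close> agree there.\<close>
  show "m x \<noteq> x" using facts tau0_tau2_neq by (metis m_def)
  show "m (m x) = x" using facts by (metis m_def)
  have "permutation s" using s_permutes finite_D by (auto simp: permutation_permutes)
  then have self: "y \<in> orbit s y" for y by (rule permutation_self_in_orbit)
  obtain X where "orbit s ` D = {X}"
    using num_cycles_s unfolding num_cycles_def by (rule card_1_singletonE)
  then have "orbit s y = orbit s x" if "y \<in> D" for y using x that by blast
  then have "D \<subseteq> orbit s x" using self by blast
  then show "orbit s x = D" using permutes_orbit_subset[OF s_permutes x] by blast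
qed (rule finite_D D_nonempty s_permutes)+

lemma edge_of_D:
  assumes "x \<in> D"
  shows "edge_of x \<inter> D = {x, m x}"
proof -
  note x = D_flags[OF assms]
  have "tau2 G x \<notin> D" "tau0 G x \<notin> D" using assms c_tau0 c_tau2 x by (auto simp: D_def)
  then show ?thesis
    using assms m_D[OF assms] tau0_tau2_commute[OF x] by (auto simp: edge_of_def m_def)
qed

lemma edge_dart: "e \<in> edges G \<Longrightarrow> \<exists>x\<in>D. e = edge_of x"
proof -
  assume "e \<in> edges G"
  then obtain x where x: "x \<in> flags G" "e = edge_of x" by (auto simp: edges_eq)
  then show ?thesis
    using tau2_D_iff[OF x(1)] edge_of_tau(2)[OF x(1)] by (cases "x \<in> D") auto
qed

lemma card_D: "card D = 2 * num_edges G"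
proof -
  have "D = (\<Union>e\<in>edges G. e \<inter> D)"
    using edges_cover D_flags by (intro subset_antisym subsetI) fast+
  then have "card D = card (\<Union>e\<in>edges G. e \<inter> D)" by simp
  also have "\<dots> = (\<Sum>e\<in>edges G. card (e \<inter> D))"
  proof (rule card_UN_disjoint)
    show "\<forall>e\<in>edges G. \<forall>f\<in>edges G. e \<noteq> f \<longrightarrow> e \<inter> D \<inter> (f \<inter> D) = {}"
      using edge_eq by (metis IntE disjoint_iff)
  qed (simp_all add: finite_edges finite_D)
  also have "\<dots> = (\<Sum>e\<in>edges G. 2)"
  proof (rule sum.cong)
    fix e assume "e \<in> edges G"
    then obtain x where "x \<in> D" "e = edge_of x" using edge_dart by blast
    then show "card (e \<inter> D) = 2" using m_neq[of x] by (simp add: edge_of_D)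
  qed simp
  finally show ?thesis by (simp add: num_edges_def)
qed

lemma card_flags: "card (flags G) = 4 * num_edges G"
proof -
  have "flags G = D \<union> tau2 G ` D"
    using D_flags tau2_flags tau2_invol tau2_D_iff by (auto simp: image_iff) metis
  moreover have "D \<inter> tau2 G ` D = {}" using tau2_D_iff D_flags by blast
  moreover have "inj_on (tau2 G) D" using tau2_invol D_flags by (metis inj_onI)
  ultimately show ?thesis using finite_D card_D by (simp add: card_Un_disjoint card_image)
qed

section \<open>Edge sets as chord sets, and the genus of partial duals\<close>

lemma darts_iff: "A \<subseteq> edges G \<Longrightarrow> x \<in> darts A \<longleftrightarrow> x \<in> D \<and> edge_of x \<in> A"
  unfolding darts_def using mem_Union_edges D_flags by blast

lemma edge_of_m: "x \<in> D \<Longrightarrow> edge_of (m x) = edge_of x"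
  using D_flags tau0_flags by (simp add: m_def edge_of_tau)

lemma chord_set_darts: "A \<subseteq> edges G \<Longrightarrow> chord_set (darts A)"
  unfolding chord_set_def by (auto simp: darts_iff m_D edge_of_m)

lemma darts_Diff: "A \<subseteq> edges G \<Longrightarrow> darts (edges G - A) = D - darts A"
  by (auto simp: darts_iff edge_of_in_edges D_flags)

lemma ex_darts:
  assumes "chord_set S"
  shows "\<exists>A\<subseteq>edges G. darts A = S"
proof (intro exI conjI)
  have "S \<subseteq> D" using assms by (simp add: chord_set_def)
  then show A: "edge_of ` S \<subseteq> edges G" using D_flags edge_of_in_edges by blast
  show "darts (edge_of ` S) = S"
  proof
    show "darts (edge_of ` S) \<subseteq> S"
    proof
      fix x assume "x \<in> darts (edge_of ` S)"
      then obtain y where y: "y \<in> S" "x \<in> edge_of y \<inter> D" by (auto simp: darts_def)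
      then have "x \<in> {y, m y}" using edge_of_D \<open>S \<subseteq> D\<close> by blast
      then show "x \<in> S" using y(1) assms by (auto simp: chord_set_def)
    qed
    show "S \<subseteq> darts (edge_of ` S)" using \<open>S \<subseteq> D\<close> by (auto simp: darts_def edge_of_def)
  qed
qed

text \<open>At edges in \<open>A\<close> the new vertex-discs follow \<open>tau0\<close> in place of
  \<open>tau2\<close>; it reverses \<open>c\<close> too, so cycles on positive flags still count
  them.\<close>

lemma faces_partial_dual:
  assumes A: "A \<subseteq> edges G"
  shows "card (orbits (flags G) (tau1 G) (\<lambda>x. if x \<in> \<Union>A then tau0 G x else tau2 G x)) = faces (darts A)"
  unfolding faces_def
proof (rule card_orbits_eq_num_cycles[where c = c, OF D_def finite_flags])
  let ?g = "\<lambda>x. if x \<in> \<Union>A then tau0 G x else tau2 G x"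
  have mem: "x \<in> \<Union>A \<longleftrightarrow> edge_of x \<in> A" if "x \<in> flags G" for x
    using mem_Union_edges[OF A that] .
  show "tau1 G x \<in> flags G \<and> tau1 G (tau1 G x) = x \<and> c (tau1 G x) \<noteq> c x" if "x \<in> flags G" for x
    using that tau1_flags tau1_invol c_tau1 by blast
  show "?g x \<in> flags G \<and> ?g (?g x) = x \<and> c (?g x) \<noteq> c x" if x: "x \<in> flags G" for x
    using mem[OF x] mem[OF tau0_flags[OF x]] mem[OF tau2_flags[OF x]] edge_of_tau[OF x]
      tau0_flags[OF x] tau0_invol[OF x] tau2_flags[OF x] tau2_invol[OF x] c_tau0[OF x] c_tau2[OF x]
    by (simp del: Union_iff UN_iff)
  show "face (darts A) permutes D" using A by (intro face_permutes chord_set_darts)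
  show "face (darts A) x = ?g (tau1 G x)" if x: "x \<in> D" for x
  proof -
    define y where "y = tau1 G x"
    have y: "y \<in> flags G" using x by (simp add: y_def D_flags tau1_flags)
    have s: "s x = tau2 G y" using x by (simp add: s_def y_def)
    have "s x \<in> darts A \<longleftrightarrow> y \<in> \<Union>A"
      unfolding darts_def using s_D[OF x] mem[OF y] mem[OF tau2_flags[OF y]] edge_of_tau(2)[OF y]
      by (simp add: s del: Union_iff UN_iff)
    \<comment> \<open>Passing over to the next positive corner and then applying \<open>m\<close>
      amounts to running along the side of the ribbon.\<close>
    moreover have "m (tau2 G y) = tau0 G y"
      using y tau0_tau2_commute tau0_flags tau2_invol by (simp add: m_def)
    ultimately show ?thesis by (simp add: face_def s y_def[symmetric] del: Union_iff UN_iff)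
  qed
qed

lemma euler_genus_partial_dual:
  assumes A: "A \<subseteq> edges G"
  shows "euler_genus (partial_dual G A) =
    int (num_edges G + 2) - int (faces (darts A) + faces (D - darts A))"
proof -
  have v: "num_vertices (partial_dual G A) = faces (darts A)"
    using faces_partial_dual[OF A] isolated by (simp add: num_vertices_def partial_dual_def)
  \<comment> \<open>On flags, \<open>tau0\<close> of the dual at \<open>A\<close> is
    \<open>tau2\<close> of the dual at the complement, so boundary components of one are vertices of
    the other.\<close>
  have "orbits (flags G) (\<lambda>x. if x \<in> \<Union>A then tau2 G x else tau0 G x) (tau1 G) =
    orbits (flags G) (tau1 G) (\<lambda>x. if x \<in> \<Union>(edges G - A) then tau0 G x else tau2 G x)"
    unfolding orbits_commute[of _ _ "tau1 G"]
    using mem_Union_edges[OF A] mem_Union_edges[of "edges G - A"] edge_of_in_edges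
    by (intro orbits_cong) (auto simp del: Union_iff UN_iff)
  then have f: "num_boundary (partial_dual G A) = faces (D - darts A)"
    using faces_partial_dual[of "edges G - A"] isolated darts_Diff[OF A]
    by (simp add: num_boundary_def partial_dual_def)
  show ?thesis
    unfolding euler_genus_def v f by (simp add: num_edges_def edges_partial_dual)
qed

text \<open>\<open>faces_le\<close> for both complementary sets shows that \<open>nat\<close>
  truncates nothing.\<close>

lemma nat_genus_eq_iff:
  assumes A: "A \<subseteq> edges G"
  shows "nat (euler_genus (partial_dual G A)) = b \<longleftrightarrow>
    faces (darts A) + faces (D - darts A) + b = num_edges G + 2"
proof -
  have S: "chord_set (darts A)" using A by (rule chord_set_darts)
  have T: "chord_set (D - darts A)" using S by (simp add: chord_set_Diff)
  have "darts A \<subseteq> D" by (simp add: darts_def)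
  then have "card (darts A) + card (D - darts A) = 2 * num_edges G"
    using finite_D card_D by (metis card_Diff_subset card_mono finite_subset le_add_diff_inverse)
  then have "faces (darts A) + faces (D - darts A) \<le> num_edges G + 2"
    using faces_le[OF S] faces_le[OF T] by linarith
  then show ?thesis unfolding euler_genus_partial_dual[OF A] by linarith
qed

end

text \<open>The coefficient at \<open>b\<close> counts the members of \<open>X\<close> with exponent
  \<open>b\<close>; it is \<open>card X\<close> only if all have it.\<close>

lemma sum_monom_eq_monom_iff:
  assumes "finite X"
  shows "(\<Sum>A\<in>X. monom 1 (g A)) = (monom (of_nat (card X)) b :: int poly) \<longleftrightarrow> (\<forall>A\<in>X. g A = b)"
proof
  assume "(\<Sum>A\<in>X. monom 1 (g A)) = (monom (of_nat (card X)) b :: int poly)"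
  then have "coeff (\<Sum>A\<in>X. monom 1 (g A)) b = (of_nat (card X) :: int)" by simp
  then have "(\<Sum>A\<in>X. if g A = b then 1 else 0) = (of_nat (card X) :: int)"
    by (simp add: coeff_sum)
  then have "card {A \<in> X. g A = b} = card X"
    using assms by (simp add: sum.If_cases Int_def)
  then have "{A \<in> X. g A = b} = X" using assms by (intro card_subset_eq) auto
  then show "\<forall>A\<in>X. g A = b" by blast
next
  assume "\<forall>A\<in>X. g A = b"
  then have "(\<Sum>A\<in>X. monom 1 (g A)) = (\<Sum>A\<in>X. monom (1 :: int) b)" by (intro sum.cong) auto
  then show "(\<Sum>A\<in>X. monom 1 (g A)) = (monom (of_nat (card X)) b :: int poly)"
    by (simp add: of_nat_poly smult_monom)
qed

section \<open>Monomial polynomials and balance\<close>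

context oriented_bouquet
begin

lemma monomial_iff_balanced:
  "(\<exists>b. partial_dual_genus_poly G = monom (2 ^ num_edges G) b) \<longleftrightarrow> balanced"
proof -
  let ?N = "\<lambda>S. faces S + faces (D - S)"
  have "partial_dual_genus_poly G = monom (2 ^ num_edges G) b \<longleftrightarrow>
    (\<forall>A\<in>Pow (edges G). ?N (darts A) + b = num_edges G + 2)" for b
    using sum_monom_eq_monom_iff[of "Pow (edges G)" _ b] finite_edges nat_genus_eq_iff
    by (simp add: partial_dual_genus_poly_def card_Pow num_edges_def)
  also have "(\<forall>A\<in>Pow (edges G). ?N (darts A) + b = num_edges G + 2) \<longleftrightarrow>
    (\<forall>S. chord_set S \<longrightarrow> ?N S + b = num_edges G + 2)" for b
    using ex_darts chord_set_darts by (metis Pow_iff)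
  finally have iff: "partial_dual_genus_poly G = monom (2 ^ num_edges G) b \<longleftrightarrow>
    (\<forall>S. chord_set S \<longrightarrow> ?N S + b = num_edges G + 2)" for b .
  show ?thesis
  proof
    assume "\<exists>b. partial_dual_genus_poly G = monom (2 ^ num_edges G) b"
    then obtain b where b: "\<forall>S. chord_set S \<longrightarrow> ?N S + b = num_edges G + 2" using iff by blast
    show balanced
      unfolding balanced_def
    proof (intro allI impI)
      fix S assume "chord_set S"
      \<comment> \<open>The common value of the sum is read off at the empty set.\<close>
      then have "?N S + b = ?N {} + b" using b chord_set_simps(1) by metis
      then show "?N S = Suc (faces D)" by (simp add: faces_empty)
    qed
  next
    assume bal: balanced
    \<comment> \<open>This makes the natural-number subtraction in the exponent exact.\<close>
    have "Suc (faces D) \<le> num_edges G + 2" using faces_le[of D] card_D by simp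
    then have "\<forall>S. chord_set S \<longrightarrow> ?N S + (num_edges G + 2 - Suc (faces D)) = num_edges G + 2"
      using bal by (simp add: balanced_def)
    then show "\<exists>b. partial_dual_genus_poly G = monom (2 ^ num_edges G) b" using iff by blast
  qed
qed

subsection \<open>Interlaced loops\<close>

lemma s_eq: "x \<in> D \<Longrightarrow> s x = tau2 G (tau1 G x)"
  by (simp add: s_def)

lemma travel_D:
  assumes "x \<in> D"
  shows "((tau2 G \<circ> tau1 G) ^^ k) x = (s ^^ k) x"
proof (induction k)
  case (Suc k)
  then show ?case using s_eq[OF s_pow_closed[OF assms, of k]] by simp
qed simp

text \<open>Off \<open>D\<close>, the map \<open>tau2 \<circ> tau1\<close> travels around the vertex in the opposite direction.\<close>

lemma travel_tau2:
  assumes "x \<in> D" and "k \<le> card D"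
  shows "((tau2 G \<circ> tau1 G) ^^ k) (tau2 G x) = tau2 G ((s ^^ (card D - k)) x)"
proof -
  have return: "((tau2 G \<circ> tau1 G) ^^ k) (tau2 G ((s ^^ k) y)) = tau2 G y" if y: "y \<in> D" for y k
  proof (induction k)
    case (Suc k)
    define z where "z = (s ^^ k) y"
    have z: "z \<in> D" "z \<in> flags G" using s_pow_closed[OF y, of k] D_flags by (auto simp: z_def)
    have "(tau2 G \<circ> tau1 G) (tau2 G (s z)) = tau2 G z"
      using z tau1_flags tau1_invol tau2_invol by (simp add: s_eq)
    then have "((tau2 G \<circ> tau1 G) ^^ Suc k) (tau2 G (s z)) = tau2 G y"
      using Suc unfolding z_def by (metis comp_apply funpow_Suc_right)
    moreover have "(s ^^ Suc k) y = s z" by (simp add: z_def)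
    ultimately show ?case by (simp only:)
  qed simp
  \<comment> \<open>A full turn has \<open>card D\<close> steps, so \<open>k\<close> steps back are
    \<open>card D - k\<close> steps forward.\<close>
  have "(s ^^ k) ((s ^^ (card D - k)) x) = x"
    using s_pow_card[OF assms(1)] assms(2) by (simp flip: funpow_add o_apply[of "s ^^ k"])
  then show ?thesis using return[OF s_pow_closed[OF assms(1)], of k "card D - k"] by simp
qed

text \<open>An edge has only two ends in \<open>D\<close>, so the \<open>j\<close>-th end is
  \<open>m x\<close> and the \<open>k\<close>-th is the partner of the \<open>i\<close>-th; the arc
  up to \<open>m x\<close> separates these two.\<close>

lemma crossing_if_alternating:
  assumes e: "e \<in> edges G" and f: "f \<in> edges G" and x: "x \<in> e" "x \<in> D"
    and ijk: "0 < i" "i < j" "j < k" "k < card D"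
    and on: "(s ^^ i) x \<in> f" "(s ^^ j) x \<in> e" "(s ^^ k) x \<in> f"
  shows "crossing x ((s ^^ i) x)"
proof -
  let ?z = "(s ^^ i) x"
  note inj = inj_onD[OF s_pow_inj[OF x(2)]]
  have D: "(s ^^ l) x \<in> D" for l using x(2) by (rule s_pow_closed)
  have "e \<inter> D = {x, m x}" using edge_eq[OF e x(1)] edge_of_D[OF x(2)] by simp
  moreover have "(s ^^ j) x \<noteq> x" using inj[of j 0] ijk by auto
  ultimately have j: "(s ^^ j) x = m x" using on(2) D by blast
  have "f \<inter> D = {?z, m ?z}" using edge_eq[OF f on(1)] edge_of_D[OF D] by simp
  moreover have "(s ^^ k) x \<noteq> ?z" using inj[of k i] ijk by auto
  ultimately have k: "(s ^^ k) x = m ?z" using on(3) D by blast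
  have "?z \<noteq> x" "?z \<noteq> m x" using inj[of i 0] inj[of i j] ijk j by auto
  moreover have "?z \<in> arc x j" using ijk by (auto simp: arc_def)
  moreover have "m ?z \<notin> arc x j"
  proof
    assume "m ?z \<in> arc x j"
    then obtain l where "l < j" "(s ^^ l) x = (s ^^ k) x" using k by (auto simp: arc_def)
    then show False using inj[of l k] ijk by auto
  qed
  ultimately show ?thesis using crossing_iff_arc[OF x(2) _ j D] ijk by simp
qed

lemma interlaced_crossing:
  assumes e: "e \<in> edges G" and f: "f \<in> edges G" and "interlaced G e f"
  shows "\<exists>x\<in>e \<inter> D. \<exists>z\<in>f \<inter> D. crossing x z"
proof -
  let ?T = "tau2 G \<circ> tau1 G"
  obtain x i j k where x: "x \<in> e" and ijk: "0 < i" "i < j" "j < k" "k < card D"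
    and on: "(?T ^^ i) x \<in> f" "(?T ^^ j) x \<in> e" "(?T ^^ k) x \<in> f"
    using assms(3) unfolding interlaced_def card_D by blast
  show ?thesis
  proof (cases "x \<in> D")
    case True
    then have "crossing x ((s ^^ i) x)"
      using crossing_if_alternating[OF e f x True ijk] on travel_D by simp
    moreover have "(s ^^ i) x \<in> f \<inter> D" using on(1) travel_D[OF True] s_pow_closed[OF True] by simp
    ultimately show ?thesis using x True by blast
  next
    case False
    \<comment> \<open>Off \<open>D\<close> the tour runs backwards. Seen from the positive corner of
      the same half-edge, position \<open>l\<close> becomes \<open>card D - l\<close>, which
      reverses the order of \<open>i\<close>, \<open>j\<close>, \<open>k\<close>.\<close>
    define y where "y = tau2 G x"
    have xf: "x \<in> flags G" using x edges_subset_flags[OF e] by blast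
    have y: "y \<in> D" "y \<in> e" "tau2 G y = x"
      using False xf tau2_D_iff edge_closed[OF e x xf] tau2_invol by (auto simp: y_def)
    have mem: "(s ^^ (card D - l)) y \<in> h" if "l \<le> card D" "h \<in> edges G" "(?T ^^ l) x \<in> h" for l h
    proof -
      let ?w = "(s ^^ (card D - l)) y"
      have w: "?w \<in> flags G" using s_pow_closed[OF y(1)] D_flags by blast
      have "tau2 G ?w \<in> h" using travel_tau2[OF y(1) that(1)] that(3) y(3) by simp
      then show ?thesis using edge_closed(2)[OF that(2) _ tau2_flags[OF w]] tau2_invol[OF w] by simp
    qed
    have "crossing y ((s ^^ (card D - k)) y)"
      using ijk on mem e f
      by (intro crossing_if_alternating[OF e f y(2,1), of "card D - k" "card D - j" "card D - i"]) auto
    moreover have "(s ^^ (card D - k)) y \<in> f \<inter> D"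
      using mem[of k f] ijk f on(3) s_pow_closed[OF y(1)] by simp
    ultimately show ?thesis using y by blast
  qed
qed

text \<open>Supplies \<open>conn\<close> for \<open>balanced_antipodal\<close>: \<open>P\<close>
  passes to edges as \<open>Q\<close>, which is constant along walks in the symmetrized intersection
  graph.\<close>

lemma connected_crossing:
  assumes conn: "Digraph_Component.connected (with_proj (intersection_graph G))"
    and cross: "\<And>y z. y \<in> D \<Longrightarrow> z \<in> D \<Longrightarrow> crossing y z \<Longrightarrow> P y \<longleftrightarrow> P z"
    and ends: "\<And>y. y \<in> D \<Longrightarrow> P (m y) \<longleftrightarrow> P y"
  shows "\<forall>y\<in>D. \<forall>z\<in>D. P y \<longrightarrow> P z"
proof (intro ballI impI)
  fix y z assume y: "y \<in> D" and z: "z \<in> D" and "P y"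
  define Q where "Q e \<longleftrightarrow> (\<exists>x\<in>e \<inter> D. P x)" for e
  have Q: "Q e \<longleftrightarrow> P x" if "e \<in> edges G" "x \<in> e" "x \<in> D" for e x
    using edge_eq[OF that(1,2)] edge_of_D[OF that(3)] ends[OF that(3)] by (auto simp: Q_def)
  have Q_interlaced: "Q e \<longleftrightarrow> Q f" if ef: "e \<in> edges G" "f \<in> edges G" "interlaced G e f" for e f
  proof -
    obtain x z where "x \<in> e \<inter> D" "z \<in> f \<inter> D" "crossing x z"
      using interlaced_crossing[OF ef] by blast
    then show ?thesis using Q ef(1,2) cross by (metis IntE)
  qed
  have E: "edge_of y \<in> edges G" "edge_of z \<in> edges G" using y z D_flags edge_of_in_edges by auto
  let ?M = "mk_symmetric (with_proj (intersection_graph G))"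
  have "(edge_of y, edge_of z) \<in> rtrancl_on (edges G) (arcs_ends (with_proj ?M))"
    using conn E unfolding connected_def strongly_connected_def reachable_def
    by (simp add: intersection_graph_def)
  then have "Q (edge_of y) \<longleftrightarrow> Q (edge_of z)"
  proof induction
    case (step e f)
    then have "(e, f) \<in> parcs ?M" by (simp add: arcs_ends_def arc_to_ends_def)
    then have "interlaced G e f \<or> interlaced G f e" "e \<in> edges G" "f \<in> edges G"
      by (auto simp: parcs_mk_symmetric intersection_graph_def)
    then show ?case using Q_interlaced step.IH by blast
  qed simp
  then show "P z" using \<open>P y\<close> Q[OF E(1) _ y] Q[OF E(2) _ z] by (simp add: edge_of_def)
qed

end

section \<open>The bouquets \<open>B\<^sub>t\<close>\<close>

lemma bouquet_B_simps:
  shows "flags (bouquet_B t) = {..<2 * t} \<times> UNIV"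
    and "tau1 (bouquet_B t) (k, b) =
      (if b then (Suc k mod (2 * t), False) else ((k + 2 * t - 1) mod (2 * t), True))"
    and "tau2 (bouquet_B t) (k, b) = (k, \<not> b)"
    and "isolated (bouquet_B t) = (if t = 0 then 1 else 0)"
  by (simp_all add: bouquet_B_def bouquet_of_def mult_2 del: upt_Suc)

text \<open>The two copies of a label are \<open>t\<close> positions apart, and equal signs make
  sides join corners of different kinds.\<close>

lemma tau0_bouquet_B:
  assumes "k < 2 * t"
  shows "tau0 (bouquet_B t) (k, b) = ((k + t) mod (2 * t), \<not> b)"
proof -
  define w where "w = map (\<lambda>a. (a, True)) ([1..<Suc t] @ [1..<Suc t])"
  have nth: "w ! l = (if l < t then Suc l else Suc (l - t), True)" if "l < 2 * t" for l
    using that by (auto simp: w_def nth_append simp del: upt_Suc)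
  have len: "length w = 2 * t" by (simp add: w_def del: upt_Suc)
  have m: "(k + t) mod (2 * t) = (if k < t then k + t else k - t)"
    using assms by (auto simp: mod_if)
  have "mate w k = (k + t) mod (2 * t)"
    unfolding mate_def
  proof (rule the_equality)
    show "(k + t) mod (2 * t) < length w \<and> (k + t) mod (2 * t) \<noteq> k \<and>
        fst (w ! ((k + t) mod (2 * t))) = fst (w ! k)"
      unfolding m len using assms nth[of k] nth[of "k + t"] nth[of "k - t"] by auto
    fix l assume l: "l < length w \<and> l \<noteq> k \<and> fst (w ! l) = fst (w ! k)"
    then have "l < 2 * t" by (simp add: len)
    then show "l = (k + t) mod (2 * t)"
      unfolding m using l nth[OF assms] nth[of l] assms by (auto split: if_splits)
  qed
  moreover have "(k + t) mod (2 * t) < 2 * t" using assms by simp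
  ultimately show ?thesis
    unfolding bouquet_B_def w_def[symmetric] bouquet_of_def using nth assms by simp
qed

text \<open>Half a turn reaches the opposite half-edge in either direction, hence from both kinds of
  corners.\<close>

lemma bouquet_B_antipodal:
  assumes "x \<in> flags (bouquet_B t)"
  shows "((tau2 (bouquet_B t) \<circ> tau1 (bouquet_B t)) ^^ t) x = tau2 (bouquet_B t) (tau0 (bouquet_B t) x)"
proof -
  let ?T = "tau2 (bouquet_B t) \<circ> tau1 (bouquet_B t)"
  obtain k b where x: "x = (k, b)" "k < 2 * t" using assms by (auto simp: bouquet_B_simps)
  \<comment> \<open>From first corners travel runs backwards; \<open>2 * t - 1\<close> is minus one
    modulo \<open>2 * t\<close>.\<close>
  have pow: "(?T ^^ i) (k, b) = ((k + i * (if b then 1 else 2 * t - 1)) mod (2 * t), b)" for i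
  proof (induction i)
    case (Suc i)
    have step: "(?T ^^ Suc i) y = ?T ((?T ^^ i) y)" for y by simp
    show ?case
    proof (cases b)
      case True
      then show ?thesis unfolding step Suc by (simp add: bouquet_B_simps mod_Suc_eq)
    next
      case False
      have "(?T ^^ Suc i) (k, b) = (((k + i * (2 * t - 1)) mod (2 * t) + 2 * t - 1) mod (2 * t), False)"
        unfolding step Suc using False by (simp add: bouquet_B_simps)
      also have "(k + i * (2 * t - 1)) mod (2 * t) + 2 * t - 1 = (k + i * (2 * t - 1)) mod (2 * t) + (2 * t - 1)"
        using x(2) by linarith
      finally show ?thesis
        unfolding mod_add_left_eq using False by (simp add: ac_simps)
    qed
  qed (simp add: x(2))
  have "(k + t * (2 * t - 1)) mod (2 * t) = (k + t) mod (2 * t)"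
  proof -
    obtain u where "t = Suc u" using x(2) by (cases t) auto
    then have "k + t * (2 * t - 1) = k + t + 2 * t * u" by (simp add: algebra_simps)
    then show ?thesis by (simp only: mod_mult_self2)
  qed
  then show ?thesis using x pow[of t] by (simp add: tau0_bouquet_B bouquet_B_simps)
qed

section \<open>Recognizing \<open>bouquet_B\<close> by antipodality\<close>

context oriented_bouquet
begin

text \<open>An equivalence need not match \<open>c\<close> with the kinds of corners; as
  \<open>bouquet_B_antipodal\<close> covers both kinds, orientations are never compared.\<close>

lemma equiv_bouquet_B_antipodal:
  assumes "ribbon_equiv G (bouquet_B t)"
  shows "num_edges G = t" and "\<forall>x\<in>D. m x = (s ^^ t) x"
proof -
  let ?B = "bouquet_B t"
  obtain \<phi> where bij: "bij_betw \<phi> (flags G) (flags ?B)" and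
    hom: "\<And>x. x \<in> flags G \<Longrightarrow> \<phi> (tau0 G x) = tau0 ?B (\<phi> x)"
      "\<And>x. x \<in> flags G \<Longrightarrow> \<phi> (tau1 G x) = tau1 ?B (\<phi> x)"
      "\<And>x. x \<in> flags G \<Longrightarrow> \<phi> (tau2 G x) = tau2 ?B (\<phi> x)"
    using assms unfolding ribbon_equiv_def by blast
  show "num_edges G = t"
    using bij_betw_same_card[OF bij] card_flags by (simp add: bouquet_B_simps card_cartesian_product)
  show "\<forall>x\<in>D. m x = (s ^^ t) x"
  proof
    fix x assume x: "x \<in> D"
    have "\<phi> ((s ^^ i) x) = ((tau2 ?B \<circ> tau1 ?B) ^^ i) (\<phi> x)" for i
    proof (induction i)
      case (Suc i)
      have "(s ^^ i) x \<in> D" using x by (rule s_pow_closed)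
      then show ?case using Suc hom tau1_flags D_flags by (simp add: s_eq)
    qed simp
    moreover have "\<phi> x \<in> flags ?B" using bij D_flags[OF x] by (metis bij_betw_apply)
    ultimately have "\<phi> ((s ^^ t) x) = \<phi> (m x)"
      using hom D_flags[OF x] tau0_flags by (simp add: bouquet_B_antipodal m_def)
    moreover have "(s ^^ t) x \<in> flags G" "m x \<in> flags G"
      using s_pow_closed[OF x] m_D[OF x] D_flags by auto
    ultimately show "m x = (s ^^ t) x" using bij by (metis bij_betw_imp_inj_on inj_onD)
  qed
qed

text \<open>An antipodal \<open>m\<close> is a power of \<open>s\<close> on \<open>D\<close>, so
  numbering the half-edges cyclically from any one of them determines all three involutions.\<close>

lemma antipodal_equiv_bouquet_B:
  assumes anti: "\<forall>x\<in>D. m x = (s ^^ (num_edges G)) x"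
  shows "ribbon_equiv G (bouquet_B (num_edges G))"
proof -
  define n where "n = num_edges G"
  let ?B = "bouquet_B n"
  obtain x where x: "x \<in> D" using D_nonempty by blast
  \<comment> \<open>Last corners go to positive flags, since from both the travel runs forwards;
    first corners go to their \<open>tau2\<close>-partners.\<close>
  define \<psi> where "\<psi> = (\<lambda>(k, b). if b then (s ^^ k) x else tau2 G ((s ^^ k) x))"
  have n: "card D = 2 * n" "0 < n"
    using card_D x finite_D by (auto simp: n_def card_gt_0_iff intro!: Nat.gr0I)
  have D: "(s ^^ k) x \<in> D" "(s ^^ k) x \<in> flags G" for k using s_pow_closed[OF x] D_flags by auto
  have mod: "(s ^^ (k mod (2 * n))) x = (s ^^ k) x" for k
    using s_pow_card[OF x] n(1) by (metis funpow_mod_eq)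
  have \<psi>_flags: "\<psi> y \<in> flags G" for y using D tau2_flags by (auto simp: \<psi>_def split: prod.splits)
  have inj: "inj_on \<psi> (flags ?B)"
  proof (rule inj_onI)
    fix y y' assume y: "y \<in> flags ?B" "y' \<in> flags ?B" and eq: "\<psi> y = \<psi> y'"
    obtain k b k' b' where y': "y = (k, b)" "y' = (k', b')" "k < 2 * n" "k' < 2 * n"
      using y by (auto simp: bouquet_B_simps)
    have "c (\<psi> y) \<longleftrightarrow> b" "c (\<psi> y') \<longleftrightarrow> b'" using D c_tau2 by (auto simp: \<psi>_def y' D_def)
    then have b: "b = b'" using eq by simp
    then have "(s ^^ k) x = (s ^^ k') x"
      using eq D tau2_invol by (auto simp: \<psi>_def y' split: if_splits) (metis D(2) tau2_invol)
    then show "y = y'" using inj_onD[OF s_pow_inj[OF x], of k k'] y' b n by simp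
  qed
  have "\<psi> ` flags ?B = flags G"
  proof (rule card_subset_eq)
    show "card (\<psi> ` flags ?B) = card (flags G)"
      using card_image[OF inj] card_flags by (simp add: bouquet_B_simps card_cartesian_product n_def)
  qed (use finite_flags \<psi>_flags in auto)
  with inj have bij: "bij_betw \<psi> (flags ?B) (flags G)" by (simp add: bij_betw_def)
  interpret B: ribbon_graph ?B by (rule ribbon_graph_bouquet_B)
  have hom: "\<psi> (tau0 ?B y) = tau0 G (\<psi> y) \<and> \<psi> (tau1 ?B y) = tau1 G (\<psi> y) \<and> \<psi> (tau2 ?B y) = tau2 G (\<psi> y)"
    if yB: "y \<in> flags ?B" for y
  proof -
    obtain k b where y: "y = (k, b)" "k < 2 * n" using yB by (auto simp: bouquet_B_simps)
    have m: "m ((s ^^ k) x) = (s ^^ (k + n)) x"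
    proof -
      have "m ((s ^^ k) x) = (s ^^ n) ((s ^^ k) x)" using anti D(1) unfolding n_def by blast
      then show ?thesis by (simp only: add.commute[of k] funpow_add o_apply)
    qed
    have t0: "tau0 G ((s ^^ k) x) = tau2 G ((s ^^ (k + n)) x)"
      unfolding m[symmetric] using D tau0_flags tau2_invol by (simp add: m_def)
    have t02: "tau0 G (tau2 G ((s ^^ k) x)) = (s ^^ (k + n)) x"
      unfolding m[symmetric] using D tau0_tau2_commute by (simp add: m_def)
    have t1: "tau1 G ((s ^^ k) x) = tau2 G ((s ^^ Suc k) x)" for k
      using D(1)[of k] D(2)[of k] tau1_flags tau2_invol by (simp add: s_eq)
    \<comment> \<open>One step back is written as \<open>2 * n - 1\<close> steps forward, so
      \<open>k = 0\<close> is no exception.\<close>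
    have t12: "tau1 G (tau2 G ((s ^^ k) x)) = (s ^^ (k + 2 * n - 1)) x"
    proof -
      have "(s ^^ Suc (k + 2 * n - 1)) x = (s ^^ k) x"
        using mod[of "k + 2 * n"] mod[of k] n(2) by simp
      then show ?thesis using t1[of "k + 2 * n - 1"] D tau1_invol by metis
    qed
    show ?thesis
      using y D mod[of "k + n"] mod[of "Suc k"] mod[of "k + 2 * n - 1"] t0 t02 t1[of k] t12 tau2_invol
      by (cases b) (simp_all add: tau0_bouquet_B bouquet_B_simps \<psi>_def)
  qed
  \<comment> \<open>The numbering maps into \<open>G\<close>; \<open>ribbon_equiv\<close> asks for
    the opposite direction.\<close>
  define \<phi> where "\<phi> = inv_into (flags ?B) \<psi>"
  have \<phi>: "\<phi> (\<psi> y) = y" if "y \<in> flags ?B" for y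
    using bij_betw_inv_into_left[OF bij that] by (simp add: \<phi>_def)
  have "\<phi> (tau0 G z) = tau0 ?B (\<phi> z) \<and> \<phi> (tau1 G z) = tau1 ?B (\<phi> z) \<and> \<phi> (tau2 G z) = tau2 ?B (\<phi> z)"
    if z: "z \<in> flags G" for z
  proof -
    obtain y where y: "y \<in> flags ?B" "z = \<psi> y" using bij_betw_imp_surj_on[OF bij] z by blast
    have "\<phi> (\<psi> (tau0 ?B y)) = tau0 ?B y" "\<phi> (\<psi> (tau1 ?B y)) = tau1 ?B y" "\<phi> (\<psi> (tau2 ?B y)) = tau2 ?B y"
      using y(1) by (simp_all only: \<phi> B.tau0_flags B.tau1_flags B.tau2_flags)
    then show ?thesis using hom[OF y(1)] \<phi>[OF y(1)] by (simp add: y(2))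
  qed
  moreover have "bij_betw \<phi> (flags G) (flags ?B)" unfolding \<phi>_def using bij by (rule bij_betw_inv_into)
  moreover have "isolated G = isolated ?B" using isolated n(2) by (simp add: bouquet_B_simps)
  ultimately show ?thesis unfolding ribbon_equiv_def n_def by blast
qed

lemma monomial_iff_equiv_bouquet_B:
  assumes "Digraph_Component.connected (with_proj (intersection_graph G))"
  shows "(\<exists>b. partial_dual_genus_poly G = monom (2 ^ num_edges G) b) \<longleftrightarrow>
    (\<exists>i. ribbon_equiv G (bouquet_B (2 * i + 1)))"
proof -
  have n: "card D div 2 = num_edges G" using card_D by simp
  have "balanced \<longleftrightarrow> odd (num_edges G) \<and> (\<forall>x\<in>D. m x = (s ^^ num_edges G) x)"
    using balanced_antipodal[OF _ connected_crossing[OF assms]] antipodal_balanced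
    unfolding n by blast
  also have "\<dots> \<longleftrightarrow> (\<exists>i. ribbon_equiv G (bouquet_B (2 * i + 1)))"
    using antipodal_equiv_bouquet_B equiv_bouquet_B_antipodal by (metis even_plus_one_iff dvd_triv_left oddE)
  finally show ?thesis unfolding monomial_iff_balanced .
qed

end

theorem theorem27:
  fixes B :: "'a ribbon_graph"
  assumes "bouquet B"
    and "num_edges B \<ge> 1"
    and "prime_bouquet B"
    and "orientable B"
  shows "(\<exists>b :: nat. partial_dual_genus_poly B = monom (2 ^ num_edges B) b) \<longleftrightarrow>
         (\<exists>i :: nat. ribbon_equiv B (bouquet_B (2 * i + 1)))"
proof -
  interpret ribbon_graph B using assms(1) by (simp add: bouquet_def)
  obtain c :: "'a \<Rightarrow> bool" where c: "\<forall>x\<in>flags B. c (tau1 B x) \<noteq> c x \<and> c (tau2 B x) \<noteq> c x"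
    "\<forall>x\<in>flags B \<inter> \<Union>(edges B). c (tau0 B x) \<noteq> c x"
    using assms(4) unfolding orientable_def orientable_on_def by blast
  have c0: "c (tau0 B x) \<noteq> c x" if "x \<in> flags B" for x
    using c(2) IntI[OF that edges_cover[OF that]] by (rule bspec)
  \<comment> \<open>An edge consists of flags, so the bouquet is not just an isolated
    vertex.\<close>
  have "flags B \<noteq> {}"
    using assms(2) by (auto simp: num_edges_def edges_eq)
  moreover have "num_vertices B = 1" using assms(1) by (simp add: bouquet_def)
  ultimately interpret oriented_bouquet B c
    using c(1) c0 by unfold_locales simp_all
  show ?thesis
    using monomial_iff_equiv_bouquet_B assms(3) by (simp add: prime_bouquet_def)
qed

end
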